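(* Let $A\subseteq B$ be an integral, birational extension of integral domains with $\dim A\leq 1$. Then $M\mathcal{I}(A,B)=0$ if and only if $A$ is subintegrally closed in $B$ and the extension $A\subseteq B$ is anodal.
   Context: All rings are commutative with $1$ and ring homomorphisms are unitary; $X$ is an indeterminate; $\dim$ is Krull dimension. An extension $A\subseteq B$ of domains is birational if $A$ and $B$ have the same quotient field. For a ring extension $A\subseteq B$, an $A$-submodule $I$ of $B$ is invertible if there is an $A$-submodule $J$ of $B$ with $IJ=A$; $\mathcal{I}(A,B)$ is the group, under multiplication, of invertible $A$-submodules of $B$. $M\mathcal{I}(A,B)$ denotes the cokernel of the natural map $\mathcal{I}(A,B)\to\mathcal{I}(A[X,X^{-1}],B[X,X^{-1}])$, $I\mapsto I A[X,X^{-1}]$; "$=0$" means that this group is trivial. $A$ is subintegrally closed in $B$ if whenever $b\in B$ and $b^2,b^3\in A$ then $b\in A$. The extension $A\subseteq B$ is anodal if every $b\in B$ such that $b^2-b\in A$ and $b^3-b^2\in A$ belongs to $A$. *)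

theory Defs
  imports
    "HOL-Algebra.Algebraic_Closure_Type"
    "HOL-Algebra.Elementary_Groups"
    "HOL-Computational_Algebra.Fraction_Field"
    "HOL-Computational_Algebra.Polynomial"
    "HOL-Library.Extended_Nat"
    "HOL-Library.Poly_Mapping"
begin

text \<open>Rings are represented as subrings (sets) of an ambient type of class \<open>comm_ring_1\<close>, or of
  class \<open>idom\<close> where integral domains are meant; a ring extension is an inclusion of two of them.\<close>

definition ring_on :: "'a::comm_ring_1 set \<Rightarrow> 'a ring" where
  "ring_on A = ring_of_type_algebra \<lparr>carrier := A\<rparr>"

definition ring_extension :: "'a::comm_ring_1 set \<Rightarrow> 'a set \<Rightarrow> bool" where
  "ring_extension A B \<longleftrightarrow>
     subring A ring_of_type_algebra \<and> subring B ring_of_type_algebra \<and> A \<subseteq> B"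

definition krull_dim :: "'a::comm_ring_1 set \<Rightarrow> enat" where
  "krull_dim A =
     (SUP n \<in> {n. \<exists>P. (\<forall>i\<le>n. primeideal (P i) (ring_on A)) \<and> (\<forall>i<n. P i \<subset> P (Suc i))}. enat n)"

definition integral_extension :: "'a::comm_ring_1 set \<Rightarrow> 'a set \<Rightarrow> bool" where
  "integral_extension A B \<longleftrightarrow>
     (\<forall>b\<in>B. \<exists>p. lead_coeff p = 1 \<and> (\<forall>i. Polynomial.coeff p i \<in> A) \<and> poly p b = 0)"

text \<open>The quotient field of a subring, as a subfield of the quotient field of the ambient integral domain.\<close>

definition quotient_field :: "'a::idom set \<Rightarrow> 'a fract set" where
  "quotient_field A = {Fract a s | a s. a \<in> A \<and> s \<in> A \<and> s \<noteq> 0}"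

definition birational :: "'a::idom set \<Rightarrow> 'a set \<Rightarrow> bool" where
  "birational A B \<longleftrightarrow> quotient_field A = quotient_field B"

definition submodule_of :: "'a::comm_ring_1 set \<Rightarrow> 'a set \<Rightarrow> 'a set \<Rightarrow> bool" where
  "submodule_of A B I \<longleftrightarrow>
     I \<subseteq> B \<and> 0 \<in> I \<and> (\<forall>x\<in>I. \<forall>y\<in>I. x + y \<in> I) \<and> (\<forall>a\<in>A. \<forall>x\<in>I. a * x \<in> I)"

definition submodule_prod :: "'a::comm_ring_1 set \<Rightarrow> 'a set \<Rightarrow> 'a set" where
  "submodule_prod I J = {(\<Sum>k<n. x k * y k) | (n::nat) x y. \<forall>k<n. x k \<in> I \<and> y k \<in> J}"

definition invertible_submodule :: "'a::comm_ring_1 set \<Rightarrow> 'a set \<Rightarrow> 'a set \<Rightarrow> bool" where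
  "invertible_submodule A B I \<longleftrightarrow>
     submodule_of A B I \<and> (\<exists>J. submodule_of A B J \<and> submodule_prod I J = A)"

definition invertible_group :: "'a::comm_ring_1 set \<Rightarrow> 'a set \<Rightarrow> 'a set monoid" where
  "invertible_group A B =
     \<lparr>carrier = {I. invertible_submodule A B I}, monoid.mult = submodule_prod, one = A\<rparr>"

text \<open>\<open>int \<Rightarrow>\<^sub>0 'a\<close> with its convolution product is the Laurent polynomial ring over \<open>'a\<close>: the
  coefficient of \<open>X\<^sup>n\<close> in \<open>f\<close> is \<open>Poly_Mapping.lookup f n\<close>, and \<open>Poly_Mapping.single 0\<close> is the embedding
  of constants.\<close>

definition laurent :: "'a::comm_ring_1 set \<Rightarrow> (int \<Rightarrow>\<^sub>0 'a) set" where
  "laurent A = {f. \<forall>n. Poly_Mapping.lookup f n \<in> A}"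

definition laurent_extend :: "'a::comm_ring_1 set \<Rightarrow> 'a set \<Rightarrow> (int \<Rightarrow>\<^sub>0 'a) set" where
  "laurent_extend A I = submodule_prod (Poly_Mapping.single 0 ` I) (laurent A)"

definition MI :: "'a::comm_ring_1 set \<Rightarrow> 'a set \<Rightarrow> (int \<Rightarrow>\<^sub>0 'a) set set monoid" where
  "MI A B = invertible_group (laurent A) (laurent B)
     Mod (laurent_extend A ` carrier (invertible_group A B))"

definition subintegrally_closed :: "'a::comm_ring_1 set \<Rightarrow> 'a set \<Rightarrow> bool" where
  "subintegrally_closed A B \<longleftrightarrow> (\<forall>b\<in>B. b ^ 2 \<in> A \<and> b ^ 3 \<in> A \<longrightarrow> b \<in> A)"

definition anodal :: "'a::comm_ring_1 set \<Rightarrow> 'a set \<Rightarrow> bool" where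
  "anodal A B \<longleftrightarrow> (\<forall>b\<in>B. b ^ 2 - b \<in> A \<and> b ^ 3 - b ^ 2 \<in> A \<longrightarrow> b \<in> A)"

end

theory Submission
  imports Defs
begin

text \<open>
  Let \<open>I\<close> be an invertible \<open>A[X, X\<^sup>-\<^sup>1]\<close>-submodule of \<open>B[X, X\<^sup>-\<^sup>1]\<close> with inverse \<open>J\<close>. It is extended from
  \<open>A\<close> iff it is homogeneous, i.e. iff \<open>f\<^sub>n g\<^sub>m \<in> A\<close> for all coefficients of \<open>f \<in> I\<close> and \<open>g \<in> J\<close>.

  If all \<open>I\<close> are extended and \<open>b\<^sup>2, b\<^sup>3 \<in> A\<close>, apply this to \<open>(1 + b X, b\<^sup>2 X\<^sup>2)\<close>, with inverse
  \<open>(1 - b X, b\<^sup>2 X\<^sup>2)\<close>; if \<open>c = b\<^sup>2 - b\<close> and \<open>b c\<close> are in \<open>A\<close>, apply it to \<open>(1 - b + b X, c)\<close>, with inverse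
  \<open>(1 - b + b X\<^sup>-\<^sup>1, c)\<close>. Both times \<open>b \<in> A\<close> results.

  Conversely, let \<open>R\<close> be generated over \<open>A\<close> by the finitely many coefficients involved in some \<open>f\<close>,
  \<open>g\<close> and in an equation \<open>1 = \<Sum> f\<^sub>i g\<^sub>i\<close>. Its conductor \<open>C\<close> in \<open>A\<close> is nonzero by birationality and integrality,
  and radical since \<open>A\<close> is subintegrally closed. As \<open>dim A \<le> 1\<close>, the ring \<open>R / C\<close> is von Neumann regular,
  and anodality puts its idempotents into \<open>A / C\<close>. Hence for a prime \<open>P \<supseteq> C\<close> of \<open>A\<close> the localisation of
  \<open>R / C\<close> at \<open>P\<close> is a field. Over a field extension \<open>K / k\<close>, long division shows that an invertible
  \<open>k[X, X\<^sup>-\<^sup>1]\<close>-submodule of \<open>K[X, X\<^sup>-\<^sup>1]\<close> is generated by a unit \<open>c X\<^sup>n\<close>. So \<open>f\<^sub>n g\<^sub>m\<close> lies in \<open>A\<close> locally at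
  every \<open>P\<close>.
\<close>

subsection \<open>Submodules of ring extensions\<close>

abbreviation is_subring :: "'a::comm_ring_1 set \<Rightarrow> bool" where
  "is_subring A \<equiv> subring A ring_of_type_algebra"

text \<open>Subrings come from the record-based library while all calculations use type-class
  operations. The point to check is that the additive inverse of the record is the ordinary
  \<open>-\<close>.\<close>

lemma is_subring_iff:
  "is_subring A \<longleftrightarrow> 1 \<in> A \<and> (\<forall>x\<in>A. - x \<in> A) \<and> (\<forall>x\<in>A. \<forall>y\<in>A. x + y \<in> A) \<and> (\<forall>x\<in>A. \<forall>y\<in>A. x * y \<in> A)"
proof -
  interpret R: cring "ring_of_type_algebra :: 'a ring"
    by (rule cring_from_type_algebra)
  have neg: "\<ominus>\<^bsub>ring_of_type_algebra\<^esub> x = - x" for x :: 'a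
    by (rule R.minus_equality) (auto simp: ring_of_type_algebra_def)
  show ?thesis
  proof
    assume "is_subring A"
    from subringE[OF this] show "1 \<in> A \<and> (\<forall>x\<in>A. - x \<in> A) \<and> (\<forall>x\<in>A. \<forall>y\<in>A. x + y \<in> A) \<and> (\<forall>x\<in>A. \<forall>y\<in>A. x * y \<in> A)"
      unfolding neg by (auto simp: ring_of_type_algebra_def)
  next
    assume "1 \<in> A \<and> (\<forall>x\<in>A. - x \<in> A) \<and> (\<forall>x\<in>A. \<forall>y\<in>A. x + y \<in> A) \<and> (\<forall>x\<in>A. \<forall>y\<in>A. x * y \<in> A)"
    then show "is_subring A"
      by (intro R.subringI) (simp_all only: neg, auto simp: ring_of_type_algebra_def)
  qed
qed

lemma is_subringI:
  assumes "1 \<in> A" "\<And>x. x \<in> A \<Longrightarrow> - x \<in> A" "\<And>x y. x \<in> A \<Longrightarrow> y \<in> A \<Longrightarrow> x + y \<in> A"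
    "\<And>x y. x \<in> A \<Longrightarrow> y \<in> A \<Longrightarrow> x * y \<in> A"
  shows "is_subring A"
  using assms by (auto simp: is_subring_iff)

context
  fixes A :: "'a::comm_ring_1 set"
  assumes A: "is_subring A"
begin

lemma one_mem: "1 \<in> A" 
  and uminus_mem: "x \<in> A \<Longrightarrow> - x \<in> A" 
  and add_mem: "x \<in> A \<Longrightarrow> y \<in> A \<Longrightarrow> x + y \<in> A"
  and mult_mem: "x \<in> A \<Longrightarrow> y \<in> A \<Longrightarrow> x * y \<in> A"
  using A by (auto simp: is_subring_iff)

lemma zero_mem: "0 \<in> A" 
  using add_mem[OF one_mem uminus_mem[OF one_mem]] by simp

lemma diff_mem: "x \<in> A \<Longrightarrow> y \<in> A \<Longrightarrow> x - y \<in> A"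
  using add_mem[of x "- y"] uminus_mem by simp

lemma power_mem: "x \<in> A \<Longrightarrow> x ^ n \<in> A"
  by (induction n) (auto intro: one_mem mult_mem)

lemma sum_mem: "(\<And>i. i \<in> S \<Longrightarrow> f i \<in> A) \<Longrightarrow> sum f S \<in> A"
  by (induction S rule: infinite_finite_induct) (auto intro: zero_mem add_mem)

lemmas mem_intros = one_mem zero_mem uminus_mem add_mem diff_mem mult_mem power_mem

end

lemma submodule_ofD:
  assumes "submodule_of A B I"
  shows "x \<in> I \<Longrightarrow> x \<in> B" "0 \<in> I" "x \<in> I \<Longrightarrow> y \<in> I \<Longrightarrow> x + y \<in> I"
    "a \<in> A \<Longrightarrow> x \<in> I \<Longrightarrow> a * x \<in> I" "x \<in> I \<Longrightarrow> a \<in> A \<Longrightarrow> x * a \<in> I"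
  using assms by (auto simp: submodule_of_def mult.commute)

lemma submodule_of_sum:
  assumes "submodule_of A B I" "\<And>i. i \<in> S \<Longrightarrow> f i \<in> I"
  shows "sum f S \<in> I"
  using assms(2) by (induction S rule: infinite_finite_induct) (auto intro: submodule_ofD[OF assms(1)])

lemma submodule_of_diff:
  assumes "is_subring A" "submodule_of A B I" "x \<in> I" "y \<in> I"
  shows "x - y \<in> I"
proof -
  have "- 1 * y \<in> I"
    by (intro submodule_ofD(4)[OF assms(2)] assms mem_intros[OF assms(1)])
  then show ?thesis
    using submodule_ofD(3)[OF assms(2,3)] by force
qed

lemma submodule_of_self: "is_subring A \<Longrightarrow> submodule_of A A A"
  by (auto simp: submodule_of_def intro: mem_intros)

text \<open>Elements of a product module are finite sums of products, so an additive property need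
  only be checked on single products.\<close>

lemma submodule_prod_induct [consumes 1, case_names zero add mult]:
  assumes "z \<in> submodule_prod I J" "P 0" "\<And>x y. P x \<Longrightarrow> P y \<Longrightarrow> P (x + y)"
    "\<And>x y. x \<in> I \<Longrightarrow> y \<in> J \<Longrightarrow> P (x * y)"
  shows "P z"
proof -
  obtain n x y where z: "z = (\<Sum>k<n. x k * y k)" and xy: "\<forall>k<(n::nat). x k \<in> I \<and> y k \<in> J"
    using assms(1) by (auto simp: submodule_prod_def)
  from xy have "P (\<Sum>k<n. x k * y k)"
    by (induction n) (auto intro!: assms)
  then show ?thesis by (simp add: z)
qed

lemma submodule_prod_zero: "0 \<in> submodule_prod I J"
  by (auto simp: submodule_prod_def intro!: exI[of _ "0::nat"])

lemma submodule_prod_mult: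
  assumes "x \<in> I" "y \<in> J"
  shows "x * y \<in> submodule_prod I J"
  unfolding submodule_prod_def
  using assms by (intro CollectI exI[of _ "1::nat"] exI[of _ "\<lambda>_. x"] exI[of _ "\<lambda>_. y"]) auto

lemma submodule_prod_add:
  assumes "z \<in> submodule_prod I J" "w \<in> submodule_prod I J"
  shows "z + w \<in> submodule_prod I J"
proof -
  obtain n x y where z: "z = (\<Sum>k<n. x k * y k)" and xy: "\<forall>k<(n::nat). x k \<in> I \<and> y k \<in> J"
    using assms(1) by (auto simp: submodule_prod_def)
  obtain m x' y' where w: "w = (\<Sum>k<m. x' k * y' k)" and xy': "\<forall>k<(m::nat). x' k \<in> I \<and> y' k \<in> J"
    using assms(2) by (auto simp: submodule_prod_def)
  \<comment> \<open>The two families are concatenated; the second is read with its index shifted by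
    \<open>n\<close>.\<close>
  define u where "u k = (if k < n then x k else x' (k - n))" for k
  define v where "v k = (if k < n then y k else y' (k - n))" for k
  have "(\<Sum>k<n+m. u k * v k) = (\<Sum>k<n. u k * v k) + (\<Sum>k<m. u (n + k) * v (n + k))"
    by (induction m) (auto simp: add.assoc)
  also have "\<dots> = z + w"
    by (auto simp: z w u_def v_def)
  finally have "z + w = (\<Sum>k<n+m. u k * v k)" ..
  moreover have "\<forall>k<n+m. u k \<in> I \<and> v k \<in> J"
    using xy xy' by (auto simp: u_def v_def)
  ultimately show ?thesis
    unfolding submodule_prod_def by blast
qed

lemmas submodule_prod_intros = submodule_prod_zero submodule_prod_add submodule_prod_mult

lemma submodule_prod_commute: "submodule_prod I J = submodule_prod J I"
proof -
  have "z \<in> submodule_prod J I" if "z \<in> submodule_prod I J" for z and I J :: "'a set"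
    using that
  proof (induction rule: submodule_prod_induct)
    case (mult x y)
    then show ?case using submodule_prod_mult[of y J x I] by (simp add: mult.commute)
  qed (auto intro: submodule_prod_intros)
  then show ?thesis by blast
qed

lemma submodule_prod_assoc:
  "submodule_prod (submodule_prod I J) K = submodule_prod I (submodule_prod J K)"
proof -
  have *: "z \<in> submodule_prod I (submodule_prod J K)" if "z \<in> submodule_prod (submodule_prod I J) K" for z and I J K :: "'a set"
    using that
  proof (induction rule: submodule_prod_induct)
    case (mult x y)
    from mult(1) show ?case
    proof (induction rule: submodule_prod_induct)
      case (mult u v)
      then show ?case using \<open>y \<in> K\<close> by (auto simp: mult.assoc intro: submodule_prod_intros)
    qed (auto simp: distrib_right intro: submodule_prod_intros)
  qed (auto intro: submodule_prod_intros)
  \<comment> \<open>The reverse inclusion is the first one for \<open>K\<close>, \<open>J\<close>,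
    \<open>I\<close>, rewritten by commutativity.\<close>
  have "submodule_prod I (submodule_prod J K) \<subseteq> submodule_prod (submodule_prod I J) K"
    using *[of _ K J I] by (auto simp: submodule_prod_commute[of _ "submodule_prod J I"]
        submodule_prod_commute[of _ "submodule_prod J K"] submodule_prod_commute[of K] submodule_prod_commute[of J I])
  with * show ?thesis by blast
qed

lemma submodule_of_prod:
  assumes "is_subring B" "submodule_of A B I" "submodule_of A B J"
  shows "submodule_of A B (submodule_prod I J)"
  unfolding submodule_of_def
proof (intro conjI ballI subsetI)
  fix z assume "z \<in> submodule_prod I J"
  then show "z \<in> B"
    by (induction rule: submodule_prod_induct)
      (auto intro: mem_intros[OF assms(1)] submodule_ofD[OF assms(2)] submodule_ofD[OF assms(3)])
next
  fix a z assume a: "a \<in> A" and "z \<in> submodule_prod I J"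
  from this(2) show "a * z \<in> submodule_prod I J"
  proof (induction rule: submodule_prod_induct)
    case (mult x y)
    then have "a * x * y \<in> submodule_prod I J"
      using a by (intro submodule_prod_mult) (auto intro: submodule_ofD[OF assms(2)])
    then show ?case by (simp add: mult.assoc)
  qed (auto simp: distrib_left intro: submodule_prod_intros)
qed (auto intro: submodule_prod_intros)

lemma submodule_prod_left_unit:
  assumes "is_subring A" "submodule_of A B I"
  shows "submodule_prod A I = I"
proof (intro equalityI subsetI)
  fix z assume "z \<in> submodule_prod A I"
  then show "z \<in> I"
    by (induction rule: submodule_prod_induct) (auto intro: submodule_ofD[OF assms(2)])
next
  fix z assume "z \<in> I"
  then show "z \<in> submodule_prod A I"
    using submodule_prod_mult[OF one_mem[OF assms(1)]] by force
qed

text \<open>The product is closed under multiplication by \<open>A\<close>, so once it contains 1 it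
  contains \<open>A\<close>. Inverse pairs are recognised by this criterion below.\<close>

lemma submodule_prod_eq_ring:
  assumes A: "is_subring A" and I: "submodule_of A B I" and J: "submodule_of A B J"
    and sub: "\<And>x y. x \<in> I \<Longrightarrow> y \<in> J \<Longrightarrow> x * y \<in> A" and one: "1 \<in> submodule_prod I J"
  shows "submodule_prod I J = A"
proof (intro equalityI subsetI)
  fix z assume "z \<in> submodule_prod I J"
  then show "z \<in> A"
    by (induction rule: submodule_prod_induct) (auto intro: sub mem_intros[OF A])
next
  fix a assume a: "a \<in> A"
  have "a * z \<in> submodule_prod I J" if "z \<in> submodule_prod I J" for z
    using that
  proof (induction rule: submodule_prod_induct)
    case (mult x y)
    then have "(a * x) * y \<in> submodule_prod I J"
      using a by (intro submodule_prod_mult) (auto intro: submodule_ofD[OF I])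
    then show ?case by (simp add: mult.assoc)
  qed (auto simp: distrib_left intro: submodule_prod_intros)
  from this[OF one] show "a \<in> submodule_prod I J" by simp
qed

lemma ring_extensionD:
  assumes "ring_extension A B"
  shows "is_subring A" "is_subring B" "A \<subseteq> B"
  using assms by (auto simp: ring_extension_def)

lemma comm_group_invertible_group:
  assumes "ring_extension A B"
  shows "comm_group (invertible_group A B)"
proof (rule comm_groupI)
  note [simp] = invertible_group_def
  note AB = ring_extensionD[OF assms]
  have AA: "submodule_of A B A"
    using submodule_of_self[OF AB(1)] AB(3) by (auto simp: submodule_of_def)
  show "\<one>\<^bsub>invertible_group A B\<^esub> \<in> carrier (invertible_group A B)"
    using AA submodule_prod_left_unit[OF AB(1) AA] by (auto simp: invertible_submodule_def)
  fix I assume "I \<in> carrier (invertible_group A B)"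
  then obtain I' where I: "submodule_of A B I" "submodule_of A B I'" "submodule_prod I I' = A"
    by (auto simp: invertible_submodule_def)
  show "\<one>\<^bsub>invertible_group A B\<^esub> \<otimes>\<^bsub>invertible_group A B\<^esub> I = I"
    by (simp add: submodule_prod_left_unit[OF AB(1) I(1)])
  show "\<exists>y\<in>carrier (invertible_group A B). y \<otimes>\<^bsub>invertible_group A B\<^esub> I = \<one>\<^bsub>invertible_group A B\<^esub>"
    using I submodule_prod_commute[of I I'] unfolding invertible_group_def invertible_submodule_def by simp metis
  fix J assume "J \<in> carrier (invertible_group A B)"
  then obtain J' where J: "submodule_of A B J" "submodule_of A B J'" "submodule_prod J J' = A"
    by (auto simp: invertible_submodule_def)
  show "I \<otimes>\<^bsub>invertible_group A B\<^esub> J = J \<otimes>\<^bsub>invertible_group A B\<^esub> I"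
    by (simp add: submodule_prod_commute)
  \<comment> \<open>The inverse of \<open>submodule_prod I J\<close> is
    \<open>submodule_prod I' J'\<close>.\<close>
  have "submodule_prod (submodule_prod I J) (submodule_prod I' J') =
      submodule_prod (submodule_prod I I') (submodule_prod J J')"
    by (metis submodule_prod_assoc submodule_prod_commute)
  also have "\<dots> = A"
    by (simp add: I J submodule_prod_left_unit[OF AB(1) AA])
  finally show "I \<otimes>\<^bsub>invertible_group A B\<^esub> J \<in> carrier (invertible_group A B)"
    using submodule_of_prod[OF AB(2)] I J by (auto simp: invertible_submodule_def)
qed (simp add: invertible_group_def submodule_prod_assoc)

subsection \<open>Laurent extensions\<close>

text \<open>For integer exponents \<open>n = l + q\<close> has the single solution
  \<open>q = n - l\<close>, which collapses the convolution to a finite sum over the keys of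
  \<open>f\<close>.\<close>

lemma lookup_times_int:
  fixes f g :: "int \<Rightarrow>\<^sub>0 'a::comm_ring_1"
  shows "Poly_Mapping.lookup (f * g) n =
    (\<Sum>i\<in>Poly_Mapping.keys f. Poly_Mapping.lookup f i * Poly_Mapping.lookup g (n - i))"
proof -
  have "(\<Sum>q. Poly_Mapping.lookup g q when n = l + q) = Poly_Mapping.lookup g (n - l)" for l
  proof -
    have "n = l + q \<longleftrightarrow> q = n - l" for q
      by auto
    then show ?thesis by simp
  qed
  then have "Poly_Mapping.lookup (f * g) n = (\<Sum>l. Poly_Mapping.lookup f l * Poly_Mapping.lookup g (n - l))"
    by (simp add: lookup_mult)
  also have "\<dots> = (\<Sum>i\<in>Poly_Mapping.keys f. Poly_Mapping.lookup f i * Poly_Mapping.lookup g (n - i))"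
    by (rule Sum_any.expand_superset) (auto simp: in_keys_iff)
  finally show ?thesis .
qed

lemma lookup_single_mult_int [simp]:
  fixes f :: "int \<Rightarrow>\<^sub>0 'a::comm_ring_1"
  shows "Poly_Mapping.lookup (Poly_Mapping.single m c * f) n = c * Poly_Mapping.lookup f (n - m)"
  by (cases "c = 0") (auto simp: lookup_times_int)

lemma sum_single_lookup:
  "(\<Sum>n\<in>Poly_Mapping.keys f. Poly_Mapping.single n (Poly_Mapping.lookup f n)) = f"
  by (rule poly_mapping_eqI) (auto simp: lookup_sum lookup_single when_def in_keys_iff sum.delta)

lemma laurentI: "(\<And>n. Poly_Mapping.lookup f n \<in> A) \<Longrightarrow> f \<in> laurent A"
  and laurentD: "f \<in> laurent A \<Longrightarrow> Poly_Mapping.lookup f n \<in> A"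
  by (auto simp: laurent_def)

lemma single_in_laurent_iff:
  "0 \<in> A \<Longrightarrow> Poly_Mapping.single n x \<in> laurent A \<longleftrightarrow> x \<in> A"
  by (auto simp: laurent_def lookup_single when_def)

lemma is_subring_laurent:
  assumes "is_subring A"
  shows "is_subring (laurent A)"
  by (rule is_subringI)
    (auto simp: laurent_def lookup_one when_def lookup_add lookup_times_int
      intro!: mem_intros[OF assms] sum_mem[OF assms])

lemma ring_extension_laurent:
  "ring_extension A B \<Longrightarrow> ring_extension (laurent A) (laurent B)"
  by (auto simp: ring_extension_def is_subring_laurent intro: laurentI dest: laurentD)

lemma submodule_of_laurent:
  assumes "submodule_of A B I"
  shows "submodule_of (laurent A) (laurent B) (laurent I)"
  unfolding submodule_of_def
  by (auto simp: laurent_def lookup_add lookup_times_int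
      intro!: submodule_of_sum[OF assms] intro: submodule_ofD[OF assms] submodule_ofD(4)[OF assms])

text \<open>Coefficients of a product are sums of products of coefficients; conversely the monomial
  with coefficient \<open>x * y\<close> in degree \<open>n\<close> factors into \<open>x\<close> in
  degree \<open>n\<close> and \<open>y\<close> in degree 0. So \<open>laurent\<close> is a
  homomorphism on invertible submodules.\<close>

lemma submodule_prod_laurent:
  assumes I: "0 \<in> I" and J: "0 \<in> J"
  shows "submodule_prod (laurent I) (laurent J) = laurent (submodule_prod I J)"
proof (intro equalityI subsetI)
  fix z assume "z \<in> submodule_prod (laurent I) (laurent J)"
  then show "z \<in> laurent (submodule_prod I J)"
  proof (induction rule: submodule_prod_induct)
    case (mult f g)
    have "(\<Sum>i\<in>S. Poly_Mapping.lookup f i * Poly_Mapping.lookup g (n - i)) \<in> submodule_prod I J" for S n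
      using mult by (induction S rule: infinite_finite_induct)
        (auto intro!: submodule_prod_intros dest: laurentD)
    then show ?case
      by (auto simp: laurent_def lookup_times_int)
  qed (auto simp: laurent_def lookup_add intro: submodule_prod_intros)
next
  fix f assume f: "f \<in> laurent (submodule_prod I J)"
  have single: "Poly_Mapping.single n z \<in> submodule_prod (laurent I) (laurent J)"
    if "z \<in> submodule_prod I J" for n z
    using that
  proof (induction rule: submodule_prod_induct)
    case (mult x y)
    then show ?case
      using submodule_prod_mult[of "Poly_Mapping.single n x" "laurent I" "Poly_Mapping.single 0 y" "laurent J"] I J
      by (auto simp: mult_single single_in_laurent_iff)
  qed (auto simp: single_add intro: submodule_prod_intros)
  have "(\<Sum>n\<in>S. Poly_Mapping.single n (Poly_Mapping.lookup f n)) \<in> submodule_prod (laurent I) (laurent J)" for S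
    using f by (induction S rule: infinite_finite_induct)
      (auto intro!: submodule_prod_intros single dest: laurentD)
  from this[of "Poly_Mapping.keys f"] show "f \<in> submodule_prod (laurent I) (laurent J)"
    by (simp add: sum_single_lookup)
qed

lemma invertible_submodule_laurent:
  assumes "ring_extension A B" "invertible_submodule A B I"
  shows "invertible_submodule (laurent A) (laurent B) (laurent I)"
proof -
  obtain J where "submodule_of A B I" "submodule_of A B J" "submodule_prod I J = A"
    using assms(2) by (auto simp: invertible_submodule_def)
  then show ?thesis
    unfolding invertible_submodule_def
    using submodule_of_laurent submodule_prod_laurent[OF submodule_ofD(2) submodule_ofD(2)]
    unfolding invertible_submodule_def by blast
qed

text \<open>Each monomial with coefficient \<open>z\<close> in \<open>I\<close> is the constant
  \<open>z\<close> times a power of X. Extended modules can thus be recognised by their coefficients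
  alone.\<close>

lemma laurent_extend_eq:
  assumes "is_subring A" "submodule_of A B I"
  shows "laurent_extend A I = laurent I"
proof (intro equalityI subsetI)
  fix f assume "f \<in> laurent_extend A I"
  then show "f \<in> laurent I"
    unfolding laurent_extend_def
  proof (induction rule: submodule_prod_induct)
    case (mult x y)
    then show ?case
      using submodule_ofD(5)[OF assms(2)] by (auto simp: laurent_def)
  qed (use submodule_ofD[OF assms(2)] in \<open>auto simp: laurent_def lookup_add\<close>)
next
  fix f assume f: "f \<in> laurent I"
  have single: "Poly_Mapping.single n z \<in> laurent_extend A I" if "z \<in> I" for n z
    using that submodule_prod_mult[of "Poly_Mapping.single 0 z" "Poly_Mapping.single 0 ` I"
      "Poly_Mapping.single n 1" "laurent A"] one_mem[OF assms(1)] zero_mem[OF assms(1)]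
    by (auto simp: laurent_extend_def mult_single single_in_laurent_iff)
  have "(\<Sum>n\<in>S. Poly_Mapping.single n (Poly_Mapping.lookup f n)) \<in> laurent_extend A I" for S
    using f by (induction S rule: infinite_finite_induct)
      (auto intro: single dest: laurentD intro: submodule_prod_intros[where I = "Poly_Mapping.single 0 ` I" and J = "laurent A",
        folded laurent_extend_def])
  from this[of "Poly_Mapping.keys f"] show "f \<in> laurent_extend A I"
    by (simp add: sum_single_lookup)
qed

text \<open>A quotient group is trivial exactly when the subgroup is everything; here the subgroup
  is the image of the homomorphism \<open>laurent\<close>, normal because the group is
  abelian.\<close>

lemma trivial_group_MI_iff:
  assumes "ring_extension A B"
  shows "trivial_group (MI A B) \<longleftrightarrow>
    (\<forall>I. invertible_submodule (laurent A) (laurent B) I \<longrightarrow> (\<exists>K. invertible_submodule A B K \<and> I = laurent K))"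
proof -
  let ?G = "invertible_group A B" and ?L = "invertible_group (laurent A) (laurent B)"
  interpret G: comm_group ?G
    by (rule comm_group_invertible_group[OF assms])
  interpret L: comm_group ?L
    by (rule comm_group_invertible_group[OF ring_extension_laurent[OF assms]])
  have "laurent \<in> hom ?G ?L"
  proof (rule homI)
    fix I J assume "I \<in> carrier ?G" "J \<in> carrier ?G"
    then have "0 \<in> I" "0 \<in> J"
      by (auto simp: invertible_group_def invertible_submodule_def intro: submodule_ofD(2))
    then show "laurent (I \<otimes>\<^bsub>?G\<^esub> J) = laurent I \<otimes>\<^bsub>?L\<^esub> laurent J"
      by (simp add: invertible_group_def submodule_prod_laurent)
  qed (simp add: invertible_group_def invertible_submodule_laurent[OF assms])
  then interpret h: group_hom ?G ?L laurent
    by unfold_locales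
  let ?H = "laurent ` carrier ?G"
  interpret H: normal ?H ?L
    by (rule L.subgroup_imp_normal[OF h.img_is_subgroup])
  have "laurent_extend A ` carrier ?G = ?H"
    using laurent_extend_eq ring_extensionD(1)[OF assms]
    by (intro image_cong) (auto simp: invertible_group_def invertible_submodule_def)
  then have MI: "MI A B = ?L Mod ?H"
    by (simp add: MI_def)
  interpret M: group "?L Mod ?H"
    by (rule H.factorgroup_is_group)
  have "trivial_group (?L Mod ?H) \<longleftrightarrow> (\<forall>I\<in>carrier ?L. ?H #>\<^bsub>?L\<^esub> I = ?H)"
    by (auto simp: M.trivial_group_subset carrier_FactGroup)
  also have "\<dots> \<longleftrightarrow> carrier ?L \<subseteq> ?H"
  proof (intro iffI ballI subsetI)
    fix I assume "\<forall>I\<in>carrier ?L. ?H #>\<^bsub>?L\<^esub> I = ?H" "I \<in> carrier ?L"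
    then show "I \<in> ?H"
      using L.rcos_self[OF _ H.subgroup_axioms] by blast
  next
    fix I assume "carrier ?L \<subseteq> ?H" "I \<in> carrier ?L"
    then show "?H #>\<^bsub>?L\<^esub> I = ?H"
      by (intro L.coset_join2 H.subgroup_axioms) auto
  qed
  finally show ?thesis
    unfolding MI by (auto simp: invertible_group_def)
qed

section \<open>Two-generated invertible modules and the necessity of both conditions\<close>

text \<open>The modules generated by \<open>u\<close>, \<open>v\<close> and by \<open>u'\<close>,
  \<open>v'\<close> are inverse to each other. This common pattern serves both the subintegral and
  the anodal construction.\<close>

lemma two_generated_inverse:
  fixes R S :: "'a::comm_ring_1 set"
  assumes RS: "ring_extension R S" and uv: "u \<in> S" "v \<in> S" "u' \<in> S" "v' \<in> S"
    and w: "w \<in> R" "u * u' = 1 + w" and t: "t \<in> R" "w\<^sup>2 = v * v' * t"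
    and prods: "u * v' \<in> R" "v * u' \<in> R" "v * v' \<in> R"
  obtains I J where "submodule_of R S I" "submodule_of R S J" "submodule_prod I J = R" "u \<in> I" "u' \<in> J"
proof -
  note R = ring_extensionD(1)[OF RS] and S = ring_extensionD(2)[OF RS]
  note RI = mem_intros[OF R] and SI = mem_intros[OF S]
  have RsubS: "x \<in> R \<Longrightarrow> x \<in> S" for x
    using ring_extensionD(3)[OF RS] by blast
  define gen where "gen a b = {a * p + b * q | p q. p \<in> R \<and> q \<in> R}" for a b
  have gen: "submodule_of R S (gen a b)" if "a \<in> S" "b \<in> S" for a b
    unfolding submodule_of_def
  proof (intro conjI ballI)
    show "gen a b \<subseteq> S"
      using that by (auto simp: gen_def intro!: SI(4,6) intro: RsubS)
    show "0 \<in> gen a b"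
      unfolding gen_def by (intro CollectI exI[of _ 0]) (auto intro: RI)
  next
    fix x y assume "x \<in> gen a b" "y \<in> gen a b"
    then obtain p q p' q' where "x = a * p + b * q" "y = a * p' + b * q'" "p \<in> R" "q \<in> R" "p' \<in> R" "q' \<in> R"
      by (auto simp: gen_def)
    then show "x + y \<in> gen a b"
      unfolding gen_def by (intro CollectI exI[of _ "p + p'"] exI[of _ "q + q'"]) (auto intro: RI simp: algebra_simps)
  next
    fix c x assume "c \<in> R" "x \<in> gen a b"
    then obtain p q where "x = a * p + b * q" "p \<in> R" "q \<in> R"
      by (auto simp: gen_def)
    then show "c * x \<in> gen a b"
      unfolding gen_def using \<open>c \<in> R\<close>
      by (intro CollectI exI[of _ "c * p"] exI[of _ "c * q"]) (auto intro: RI simp: algebra_simps)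
  qed
  have mem: "a \<in> gen a b" "b \<in> gen a b" for a b
    using zero_mem[OF R] one_mem[OF R] unfolding gen_def
    by (force intro: exI[of _ 0] exI[of _ 1])+
  have "submodule_prod (gen u v) (gen u' v') = R"
  proof (rule submodule_prod_eq_ring[OF R gen[OF uv(1,2)] gen[OF uv(3,4)]])
    fix x y assume "x \<in> gen u v" "y \<in> gen u' v'"
    then obtain p q p' q' where xy: "x = u * p + v * q" "y = u' * p' + v' * q'" "p \<in> R" "q \<in> R" "p' \<in> R" "q' \<in> R"
      by (auto simp: gen_def)
    have "x * y = (1 + w) * (p * p') + u * v' * (p * q') + v * u' * (q * p') + v * v' * (q * q')"
      unfolding xy w(2)[symmetric] by (simp add: algebra_simps)
    also have "\<dots> \<in> R"
      by (intro RI prods w xy)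
    finally show "x * y \<in> R" .
  next
    note gen' = submodule_ofD(4)[OF submodule_of_prod[OF S gen[OF uv(1,2)] gen[OF uv(3,4)]]]
    \<comment> \<open>Since \<open>u * u'\<close> is \<open>1 + w\<close> and
      \<open>w\<^sup>2\<close> is a multiple of \<open>v * v'\<close>, the identity
      \<open>(1 - w) * (1 + w) + w\<^sup>2 = 1\<close> exhibits 1 in the product.\<close>
    have "(1 - w) * (u * u') + t * (v * v') \<in> submodule_prod (gen u v) (gen u' v')"
      by (intro submodule_prod_add gen' submodule_prod_mult mem RI w t)
    also have "(1 - w) * (u * u') + t * (v * v') = (1 - w) * (1 + w) + w\<^sup>2"
      by (simp add: w(2) t(2) mult.commute)
    also have "\<dots> = 1"
      by (simp add: algebra_simps power2_eq_square)
    finally show "1 \<in> submodule_prod (gen u v) (gen u' v')" .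
  qed
  then show thesis
    using that gen uv mem by blast
qed

context
  fixes A B :: "'a::comm_ring_1 set"
  assumes AB: "ring_extension A B" and triv: "trivial_group (MI A B)"
begin

text \<open>Both \<open>I\<close> and its inverse \<open>J\<close> are extended, so they contain the
  coefficients of their elements as constants; a product of two such constants is a constant in
  \<open>laurent A\<close>.\<close>

lemma coeff_mult_mem_if_trivial_MI:
  assumes IJ: "submodule_of (laurent A) (laurent B) I" "submodule_of (laurent A) (laurent B) J"
    "submodule_prod I J = laurent A" and fg: "f \<in> I" "g \<in> J"
  shows "Poly_Mapping.lookup f n * Poly_Mapping.lookup g m \<in> A"
proof -
  note inv = triv[unfolded trivial_group_MI_iff[OF AB], rule_format]
  have "invertible_submodule (laurent A) (laurent B) I"
    using IJ by (auto simp: invertible_submodule_def)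
  then obtain K where K: "I = laurent K" "0 \<in> K"
    using inv by (metis invertible_submodule_def submodule_ofD(2))
  have "invertible_submodule (laurent A) (laurent B) J"
    using IJ by (metis invertible_submodule_def submodule_prod_commute)
  then obtain L where L: "J = laurent L" "0 \<in> L"
    using inv by (metis invertible_submodule_def submodule_ofD(2))
  have "Poly_Mapping.single 0 (Poly_Mapping.lookup f n) * Poly_Mapping.single 0 (Poly_Mapping.lookup g m)
      \<in> submodule_prod I J"
    using fg K L by (intro submodule_prod_mult) (auto simp: single_in_laurent_iff intro: laurentD)
  then show ?thesis
    using IJ(3) zero_mem[OF ring_extensionD(1)[OF AB]] by (simp add: mult_single single_in_laurent_iff)
qed

lemma subintegrally_closed_if_trivial_MI: "subintegrally_closed A B"
  unfolding subintegrally_closed_def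
proof (intro ballI impI, elim conjE)
  fix b assume b: "b \<in> B" "b\<^sup>2 \<in> A" "b ^ 3 \<in> A"
  note AI = mem_intros[OF ring_extensionD(1)[OF AB]] and BI = mem_intros[OF ring_extensionD(2)[OF AB]]
  note LI = mem_intros[OF ring_extensionD(1)[OF ring_extension_laurent[OF AB]]]
    and LBI = mem_intros[OF ring_extensionD(2)[OF ring_extension_laurent[OF AB]]]
  note si = single_in_laurent_iff[OF AI(2)] single_in_laurent_iff[OF BI(2)]
  define s where "s n x = Poly_Mapping.single (int n) x" for n and x :: 'a
  have b4: "b ^ 4 \<in> A"
    using AI(6)[OF b(2,2)] by (simp add: power_add[symmetric])
  have b2: "b\<^sup>2 \<in> B"
    by (intro BI b)
  obtain I J where IJ: "submodule_of (laurent A) (laurent B) I" "submodule_of (laurent A) (laurent B) J"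
    "submodule_prod I J = laurent A" "1 + s 1 b \<in> I" "1 - s 1 b \<in> J"
  \<comment> \<open>From (1 + bX)(1 - bX) = 1 - b^2 X^2 comes \<open>w\<close>; its square is
    already \<open>v * v'\<close>, hence \<open>t = 1\<close>.\<close>
  proof (rule two_generated_inverse[OF ring_extension_laurent[OF AB], where u = "1 + s 1 b" and u' = "1 - s 1 b" and v = "s 2 (b\<^sup>2)" and v' = "s 2 (b\<^sup>2)"
        and w = "- s 2 (b\<^sup>2)" and t = 1])
    show "1 + s 1 b \<in> laurent B" "1 - s 1 b \<in> laurent B"
      using b by (auto intro!: LBI simp: s_def si)
    show "s 2 (b\<^sup>2) \<in> laurent B" "s 2 (b\<^sup>2) \<in> laurent B"
      using b2 by (auto intro!: LBI simp: s_def si)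
    show "- s 2 (b\<^sup>2) \<in> laurent A"
      using b by (auto intro!: LI simp: s_def si)
    show "1 \<in> laurent A"
      by (rule LI)
    show "(1 + s 1 b) * (1 - s 1 b) = 1 + - s 2 (b\<^sup>2)"
      by (simp add: algebra_simps s_def mult_single power2_eq_square)
    show "(- s 2 (b\<^sup>2))\<^sup>2 = s 2 (b\<^sup>2) * s 2 (b\<^sup>2) * 1"
      by (simp add: power2_eq_square)
    have "(1 + s 1 b) * s 2 (b\<^sup>2) = s 2 (b\<^sup>2) + s 3 (b ^ 3)"
      "s 2 (b\<^sup>2) * (1 - s 1 b) = s 2 (b\<^sup>2) - s 3 (b ^ 3)"
      by (simp_all add: algebra_simps s_def mult_single power2_eq_square power3_eq_cube)
    then show "(1 + s 1 b) * s 2 (b\<^sup>2) \<in> laurent A" "s 2 (b\<^sup>2) * (1 - s 1 b) \<in> laurent A"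
      using b by (auto intro!: LI simp: s_def si)
    show "s 2 (b\<^sup>2) * s 2 (b\<^sup>2) \<in> laurent A"
      using b b4 by (auto simp: s_def mult_single si power_add[symmetric])
  qed
  \<comment> \<open>The coefficient of X in 1 + bX times the constant term of 1 - bX is
    \<open>b\<close>.\<close>
  from coeff_mult_mem_if_trivial_MI[OF this, of 1 0] show "b \<in> A"
    by (simp add: s_def lookup_add lookup_minus lookup_one lookup_single)
qed

lemma anodal_if_trivial_MI: "anodal A B"
  unfolding anodal_def
proof (intro ballI impI, elim conjE)
  fix b assume b: "b \<in> B" "b\<^sup>2 - b \<in> A" "b ^ 3 - b\<^sup>2 \<in> A"
  note AI = mem_intros[OF ring_extensionD(1)[OF AB]] and BI = mem_intros[OF ring_extensionD(2)[OF AB]]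
  note LI = mem_intros[OF ring_extensionD(1)[OF ring_extension_laurent[OF AB]]]
    and LBI = mem_intros[OF ring_extensionD(2)[OF ring_extension_laurent[OF AB]]]
  note si = single_in_laurent_iff[OF AI(2)] single_in_laurent_iff[OF BI(2)]
  define s where "s n x = Poly_Mapping.single (n::int) x" for n and x :: 'a
  define c where "c = b\<^sup>2 - b"
  have c: "c \<in> A" "c \<in> B" "b * c \<in> A"
    using b ring_extensionD(3)[OF AB]
    by (auto simp: c_def algebra_simps power2_eq_square power3_eq_cube)
  \<comment> \<open>With T = 2 - X - X^(-1), the product \<open>u * v\<close> below is 1 + cT,
    because (1 - b)^2 + b^2 = 1 + 2c and b(1 - b) = -c.\<close>
  define T where "T = (1 - s 1 1) + (1 - s (-1) 1)"
  have T: "T \<in> laurent A"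
    using one_mem[OF ring_extensionD(1)[OF AB]] unfolding T_def by (intro LI(1,4,5)) (auto simp: s_def si)
  define u v where "u = s 0 (1 - b) + s 1 b" and "v = s 0 (1 - b) + s (-1) b"
  obtain I J where IJ: "submodule_of (laurent A) (laurent B) I" "submodule_of (laurent A) (laurent B) J"
    "submodule_prod I J = laurent A" "u \<in> I" "v \<in> J"
  proof (rule two_generated_inverse[OF ring_extension_laurent[OF AB], where u = u and u' = v and v = "s 0 c" and v' = "s 0 c"
        and w = "s 0 c * T" and t = "T\<^sup>2"])
    show "u \<in> laurent B" "v \<in> laurent B"
      using b unfolding u_def v_def by (auto intro!: LBI BI simp: s_def si)
    show "s 0 c \<in> laurent B" "s 0 c \<in> laurent B"
      using c by (auto simp: s_def si)
    have sc: "s 0 c \<in> laurent A"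
      using c by (auto simp: s_def si)
    show "s 0 c * T \<in> laurent A" "T\<^sup>2 \<in> laurent A"
      by (auto intro!: LI T sc)
    have "u * v = s 0 ((1 - b)\<^sup>2 + b\<^sup>2) + (s 1 (- c) + s (-1) (- c))"
      by (simp add: u_def v_def c_def algebra_simps s_def mult_single power2_eq_square single_add[symmetric])
    also have "(1 - b)\<^sup>2 + b\<^sup>2 = 1 + (c + c)"
      by (simp add: c_def algebra_simps power2_eq_square)
    also have "s 0 (1 + (c + c)) + (s 1 (- c) + s (-1) (- c)) = 1 + s 0 c * T"
      unfolding T_def s_def
      by (simp only: single_add single_uminus single_one distrib_left right_diff_distrib mult_single)
        (simp add: algebra_simps)
    finally show "u * v = 1 + s 0 c * T" .
    show "(s 0 c * T)\<^sup>2 = s 0 c * s 0 c * T\<^sup>2"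
      by (simp add: power2_eq_square algebra_simps)
    have "u * s 0 c = s 0 (c - b * c) + s 1 (b * c)" "s 0 c * v = s 0 (c - b * c) + s (-1) (b * c)"
      by (simp_all add: algebra_simps s_def u_def v_def mult_single)
    then show "u * s 0 c \<in> laurent A" "s 0 c * v \<in> laurent A"
      using c by (auto intro!: LI AI simp: s_def si)
    show "s 0 c * s 0 c \<in> laurent A"
      by (intro LI sc)
  qed
  note coeffs = coeff_mult_mem_if_trivial_MI[OF this]
  \<comment> \<open>The coefficient \<open>b\<close> of X in \<open>u\<close> is paired with the
    coefficients \<open>1 - b\<close> and \<open>b\<close> of \<open>v\<close> in degrees 0 and -1;
    the two products add up to \<open>b\<close>.\<close>
  have "b - b\<^sup>2 \<in> A" "b\<^sup>2 \<in> A"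
    using coeffs[of 1 0] coeffs[of 1 "-1"]
    by (auto simp: s_def u_def v_def lookup_add lookup_single algebra_simps power2_eq_square)
  from AI(4)[OF this] show "b \<in> A" by simp
qed

end

section \<open>Recognising extended modules\<close>

text \<open>The module of constants of \<open>I\<close> serves as \<open>K\<close>, with the
  constants of \<open>J\<close> as its inverse. The hypothesis on coefficients makes
  \<open>I\<close> and \<open>J\<close> homogeneous.\<close>

lemma extended_if_coeff_mult_mem:
  assumes AB: "ring_extension A B"
    and I: "submodule_of (laurent A) (laurent B) I" and J: "submodule_of (laurent A) (laurent B) J"
    and IJ: "submodule_prod I J = laurent A"
    and coeffs: "\<And>f g n m. f \<in> I \<Longrightarrow> g \<in> J \<Longrightarrow> Poly_Mapping.lookup f n * Poly_Mapping.lookup g m \<in> A"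
  shows "\<exists>K. invertible_submodule A B K \<and> I = laurent K"
proof -
  note A = ring_extensionD(1)[OF AB]
  note LA = ring_extensionD(1)[OF ring_extension_laurent[OF AB]]
  define const where "const I = {x. Poly_Mapping.single (0::int) x \<in> I}" for I :: "(int \<Rightarrow>\<^sub>0 'a) set"
  have sub: "submodule_of A B (const I)" if I: "submodule_of (laurent A) (laurent B) I" for I
    unfolding submodule_of_def
  proof (intro conjI ballI)
    show "const I \<subseteq> B"
    proof
      fix x assume "x \<in> const I"
      then have "Poly_Mapping.single 0 x \<in> laurent B"
        using submodule_ofD(1)[OF I] by (simp add: const_def)
      then show "x \<in> B"
        by (simp add: single_in_laurent_iff zero_mem[OF ring_extensionD(2)[OF AB]])
    qed
    fix a x assume "a \<in> A" "x \<in> const I"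
    then have "Poly_Mapping.single 0 a * Poly_Mapping.single 0 x \<in> I"
      by (intro submodule_ofD(4)[OF I]) (auto simp: single_in_laurent_iff zero_mem[OF A] const_def)
    then show "a * x \<in> const I"
      by (simp add: mult_single const_def)
  qed (use submodule_ofD(2,3)[OF I] in \<open>auto simp: const_def single_add\<close>)
  have coeff_mem: "Poly_Mapping.lookup f n \<in> const I"
    if I: "submodule_of (laurent A) (laurent B) I" and IJ: "submodule_prod I J = laurent A"
      and coeffs: "\<And>f g n m. f \<in> I \<Longrightarrow> g \<in> J \<Longrightarrow> Poly_Mapping.lookup f n * Poly_Mapping.lookup g m \<in> A"
      and f: "f \<in> I" for I J f n
  proof -
    \<comment> \<open>Writing 1 as a sum of products \<open>h * g\<close> turns a coefficient of
      \<open>f\<close> into a sum of elements \<open>h\<close> of \<open>I\<close>, each multiplied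
      by that coefficient times \<open>g\<close>, which lies in \<open>laurent A\<close>.\<close>
    have "z * Poly_Mapping.single 0 (Poly_Mapping.lookup f n) \<in> I" if "z \<in> submodule_prod I J" for z
      using that
    proof (induction rule: submodule_prod_induct)
      case (mult h g)
      then have "Poly_Mapping.single 0 (Poly_Mapping.lookup f n) * g \<in> laurent A"
        by (intro laurentI) (auto intro: coeffs f)
      then show ?case
        using submodule_ofD(4)[OF I _ mult(1)] by (metis mult.commute mult.left_commute)
    qed (use submodule_ofD(2,3)[OF I] in \<open>auto simp: distrib_right\<close>)
    from this[of 1] show ?thesis
      using one_mem[OF LA] IJ by (simp add: const_def)
  qed
  have constI: "Poly_Mapping.lookup f n \<in> const I" if "f \<in> I" for f n
    by (rule coeff_mem[OF I IJ coeffs that])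
  have constJ: "Poly_Mapping.lookup g n \<in> const J" if "g \<in> J" for g n
    by (rule coeff_mem[OF J IJ[unfolded submodule_prod_commute[of I]] _ that]) (subst mult.commute, rule coeffs)
  have "I = laurent (const I)"
  proof (intro equalityI subsetI)
    fix f assume f: "f \<in> laurent (const I)"
    have "Poly_Mapping.single n x \<in> I" if "x \<in> const I" for n x
    proof -
      have "Poly_Mapping.single n 1 * Poly_Mapping.single 0 x \<in> I"
        using that one_mem[OF A] zero_mem[OF A]
        by (intro submodule_ofD(4)[OF I]) (auto simp: const_def single_in_laurent_iff)
      then show ?thesis by (simp add: mult_single)
    qed
    then have "(\<Sum>n\<in>Poly_Mapping.keys f. Poly_Mapping.single n (Poly_Mapping.lookup f n)) \<in> I"
      using f by (intro submodule_of_sum[OF I]) (auto dest: laurentD)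
    then show "f \<in> I"
      by (simp add: sum_single_lookup)
  qed (auto intro: laurentI constI)
  moreover have "submodule_prod (const I) (const J) = A"
  proof (rule submodule_prod_eq_ring[OF A sub[OF I] sub[OF J]])
    show "x * y \<in> A" if "x \<in> const I" "y \<in> const J" for x y
      using coeffs[of "Poly_Mapping.single 0 x" "Poly_Mapping.single 0 y" 0 0] that by (simp add: const_def)
    \<comment> \<open>Reading off degree 0 turns an expression of 1 in
      \<open>submodule_prod I J\<close> into one in the product of the constants.\<close>
    have "Poly_Mapping.lookup z 0 \<in> submodule_prod (const I) (const J)" if "z \<in> submodule_prod I J" for z
      using that
    proof (induction rule: submodule_prod_induct)
      case (mult f g)
      have "(\<Sum>i\<in>S. Poly_Mapping.lookup f i * Poly_Mapping.lookup g (0 - i)) \<in> submodule_prod (const I) (const J)" for S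
        using mult by (induction S rule: infinite_finite_induct) (auto intro!: submodule_prod_intros constI constJ)
      then show ?case by (simp add: lookup_times_int)
    qed (auto simp: lookup_add intro: submodule_prod_intros)
    from this[of 1] show "1 \<in> submodule_prod (const I) (const J)"
      using one_mem[OF LA] IJ by simp
  qed
  ultimately show ?thesis
    using sub[OF I] sub[OF J] unfolding invertible_submodule_def by blast
qed

subsection \<open>Prime ideals\<close>

text \<open>An elementwise form of primeness for subrings of the ambient type;
  \<open>primeideal_ring_on\<close> leads from it to the notion that \<open>krull_dim\<close>
  uses.\<close>

definition prime_in :: "'a::comm_ring_1 set \<Rightarrow> 'a set \<Rightarrow> bool" where
  "prime_in R P \<longleftrightarrow> submodule_of R R P \<and> 1 \<notin> P \<and> (\<forall>x\<in>R. \<forall>y\<in>R. x * y \<in> P \<longrightarrow> x \<in> P \<or> y \<in> P)"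

lemma prime_inD:
  assumes "prime_in R P"
  shows "submodule_of R R P" "1 \<notin> P" "x \<in> R \<Longrightarrow> y \<in> R \<Longrightarrow> x * y \<in> P \<Longrightarrow> x \<in> P \<or> y \<in> P"
  using assms by (auto simp: prime_in_def)

text \<open>The ideal M + xR. It supplies the competitor to a maximal element in
  \<open>exists_prime_avoiding\<close> and the larger ideal in the dimension argument.\<close>

lemma submodule_of_adjoin:
  assumes R: "is_subring R" and M: "submodule_of R R M" and x: "x \<in> R"
  shows "submodule_of R R {m + x * r | m r. m \<in> M \<and> r \<in> R}" (is "submodule_of R R ?N")
    and "M \<subseteq> {m + x * r | m r. m \<in> M \<and> r \<in> R}" and "x \<in> {m + x * r | m r. m \<in> M \<and> r \<in> R}"
proof -
  note RI = mem_intros[OF R] and MD = submodule_ofD[OF M]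
  show "M \<subseteq> ?N"
    using zero_mem[OF R] by force
  show "x \<in> ?N"
    using one_mem[OF R] MD(2) by force
  show "submodule_of R R ?N"
    unfolding submodule_of_def
  proof (intro conjI ballI)
    show "?N \<subseteq> R"
      using x by (auto intro!: RI(4,6) intro: MD(1))
    show "0 \<in> ?N"
      using \<open>M \<subseteq> ?N\<close> MD(2) by blast
  next
    fix a b assume "a \<in> ?N" "b \<in> ?N"
    then obtain m r m' r' where "a = m + x * r" "b = m' + x * r'" "m \<in> M" "r \<in> R" "m' \<in> M" "r' \<in> R"
      by auto
    then show "a + b \<in> ?N"
      by (intro CollectI exI[of _ "m + m'"] exI[of _ "r + r'"]) (auto intro: RI MD simp: algebra_simps)
  next
    fix c a assume "c \<in> R" "a \<in> ?N"
    then obtain m r where "a = m + x * r" "m \<in> M" "r \<in> R"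
      by auto
    then show "c * a \<in> ?N" using \<open>c \<in> R\<close>
      by (intro CollectI exI[of _ "c * m"] exI[of _ "c * r"]) (auto intro: RI MD(4) simp: algebra_simps)
  qed
qed

text \<open>Krull's argument: Zorn gives an ideal maximal among those containing \<open>I\<close>
  and disjoint from the multiplicative set \<open>S\<close>, and such an ideal is prime.\<close>

lemma exists_prime_avoiding:
  assumes R: "is_subring R" and I: "submodule_of R R I" and S: "1 \<in> S"
    "\<And>x y. x \<in> S \<Longrightarrow> y \<in> S \<Longrightarrow> x * y \<in> S" and IS: "I \<inter> S = {}"
  obtains P where "prime_in R P" "I \<subseteq> P" "P \<inter> S = {}"
proof -
  note RI = mem_intros[OF R]
  define \<A> where "\<A> = {J. submodule_of R R J \<and> I \<subseteq> J \<and> J \<inter> S = {}}"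
  have "\<exists>M\<in>\<A>. \<forall>J\<in>\<A>. M \<subseteq> J \<longrightarrow> J = M"
  proof (rule subset_Zorn_nonempty)
    show "\<A> \<noteq> {}"
      using I IS by (auto simp: \<A>_def)
    fix \<C> assume ne: "\<C> \<noteq> {}" and chain: "subset.chain \<A> \<C>"
    then have mem: "submodule_of R R J" "I \<subseteq> J" "J \<inter> S = {}" if "J \<in> \<C>" for J
      using that by (auto simp: subset.chain_def \<A>_def)
    have "submodule_of R R (\<Union>\<C>)"
      unfolding submodule_of_def
    proof (intro conjI ballI)
      fix x y assume "x \<in> \<Union>\<C>" "y \<in> \<Union>\<C>"
      then obtain J K where "J \<in> \<C>" "K \<in> \<C>" "x \<in> J" "y \<in> K" by auto
      moreover from this have "J \<subseteq> K \<or> K \<subseteq> J"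
        using chain by (auto simp: subset.chain_def)
      ultimately show "x + y \<in> \<Union>\<C>"
        using submodule_ofD(3)[OF mem(1)] by blast
    next
      show "0 \<in> \<Union>\<C>"
        using ne submodule_ofD(2)[OF mem(1)] by blast
      fix a x assume "a \<in> R" "x \<in> \<Union>\<C>"
      then show "a * x \<in> \<Union>\<C>"
        using submodule_ofD(4)[OF mem(1)] by blast
    qed (use mem(1) in \<open>blast intro: submodule_ofD(1)\<close>)
    moreover have "I \<subseteq> \<Union>\<C>" "\<Union>\<C> \<inter> S = {}"
      using ne mem(2,3) by blast+
    ultimately show "\<Union>\<C> \<in> \<A>"
      by (simp add: \<A>_def)
  qed
  then obtain M where M: "submodule_of R R M" "I \<subseteq> M" "M \<inter> S = {}"
    and max: "\<And>J. submodule_of R R J \<Longrightarrow> I \<subseteq> J \<Longrightarrow> J \<inter> S = {} \<Longrightarrow> M \<subseteq> J \<Longrightarrow> J = M"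
    by (auto simp: \<A>_def)
  note MD = submodule_ofD[OF M(1)]
  \<comment> \<open>By maximality, adjoining any outside element \<open>x\<close> to
    \<open>M\<close> produces an ideal that meets \<open>S\<close>.\<close>
  have meet: "\<exists>m\<in>M. \<exists>r\<in>R. m + x * r \<in> S" if x: "x \<in> R" "x \<notin> M" for x
  proof (rule ccontr)
    assume *: "\<not> ?thesis"
    have "{m + x * r | m r. m \<in> M \<and> r \<in> R} = M"
      using * submodule_of_adjoin[OF R M(1) x(1)] M by (intro max) auto
    then show False
      using submodule_of_adjoin(3)[OF R M(1) x(1)] x(2) by simp
  qed
  have "x \<in> M \<or> y \<in> M" if xy: "x \<in> R" "y \<in> R" "x * y \<in> M" for x y
  proof (rule ccontr)
    assume "\<not> ?thesis"
    then obtain m r m' r' where *: "m \<in> M" "r \<in> R" "m + x * r \<in> S" "m' \<in> M" "r' \<in> R" "m' + y * r' \<in> S"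
      using meet xy by metis
    \<comment> \<open>If \<open>x * y\<close> is in \<open>M\<close>, every term of this product of
      two elements of \<open>S\<close> is in \<open>M\<close>, against disjointness.\<close>
    have "(m + x * r) * (m' + y * r') = m * (m' + y * r') + m' * (x * r) + (x * y) * (r * r')"
      by (simp add: algebra_simps)
    also have "\<dots> \<in> M"
      using * xy by (intro MD(3)[OF MD(3)[OF MD(5) MD(5)] MD(5)] RI) (auto intro: MD(1))
    finally show False
      using S(2)[OF *(3,6)] M(3) by auto
  qed
  then show thesis
    using that[of M] M S(1) by (auto simp: prime_in_def)
qed

lemma exists_prime_containing:
  assumes "is_subring R" "submodule_of R R I" "1 \<notin> I"
  obtains P where "prime_in R P" "I \<subseteq> P"
  by (rule exists_prime_avoiding[OF assms(1,2), of "{1}"]) (use assms(3) in auto)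

lemma primeideal_ring_on:
  assumes A: "is_subring A" and P: "prime_in A P"
  shows "primeideal P (ring_on A)"
proof -
  note PD = prime_inD[OF P] and SD = submodule_ofD[OF prime_inD(1)[OF P]]
  interpret R: cring "ring_of_type_algebra :: 'a ring"
    by (rule cring_from_type_algebra)
  have "cring (ring_on A)"
    unfolding ring_on_def using R.subcring_iff[of A] R.subcringI'[OF A] subringE(1)[OF A] by simp
  then interpret A: cring "ring_on A" .
  have [simp]: "carrier (ring_on A) = A" "x \<otimes>\<^bsub>ring_on A\<^esub> y = x * y" "x \<oplus>\<^bsub>ring_on A\<^esub> y = x + y"
    "\<zero>\<^bsub>ring_on A\<^esub> = 0" for x y
    by (simp_all add: ring_on_def ring_of_type_algebra_def)
  have neg: "\<ominus>\<^bsub>ring_on A\<^esub> x = - x" if "x \<in> A" for x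
    using that uminus_mem[OF A] by (intro A.minus_equality) auto
  have uminusP: "- x \<in> P" if "x \<in> P" for x
    using submodule_of_diff[OF A PD(1) SD(2) that] by simp
  have "subgroup P (add_monoid (ring_on A))"
    by (rule group.subgroupI[OF A.a_group]) (use SD neg uminusP in \<open>auto simp: a_inv_def\<close>)
  then have "ideal P (ring_on A)"
    by (intro idealI) (auto intro: SD A.ring_axioms)
  then show ?thesis
    using PD one_mem[OF A] by (intro primeidealI A.is_cring) auto
qed

text \<open>Nonzero primes are maximal: otherwise P + aA is proper, hence inside a prime
  \<open>M\<close>, and 0, \<open>P\<close>, \<open>M\<close> form a chain of length 2.\<close>

lemma invertible_mod_prime_if_krull_dim_le_1:
  fixes A :: "'a::idom set"
  assumes A: "is_subring A" and dim: "krull_dim A \<le> 1" and P: "prime_in A P"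
    and x: "x \<in> P" "x \<noteq> 0" and a: "a \<in> A" "a \<notin> P"
  shows "\<exists>y\<in>A. 1 - a * y \<in> P"
proof (rule ccontr)
  assume no: "\<not> ?thesis"
  note PD = prime_inD[OF P]
  let ?N = "{m + a * r | m r. m \<in> P \<and> r \<in> A}"
  note N = submodule_of_adjoin[OF A PD(1) a(1)]
  have "1 \<notin> ?N"
  proof
    assume "1 \<in> ?N"
    then obtain m r where "1 = m + a * r" "m \<in> P" "r \<in> A" by auto
    then have "r \<in> A" "1 - a * r \<in> P"
      by (metis add_diff_cancel_right')+
    with no show False by blast
  qed
  then obtain M where M: "prime_in A M" "?N \<subseteq> M"
    using exists_prime_containing[OF A N(1)] by blast
  have zero: "prime_in A {0}"
    by (auto simp: prime_in_def submodule_of_def zero_mem[OF A])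
  \<comment> \<open>The chain is an infinite sequence, constant from index 2 on; only the indices 0,
    1, 2 matter.\<close>
  define f :: "nat \<Rightarrow> 'a set" where "f n = (if n = 0 then {0} else if n = 1 then P else M)" for n
  have "primeideal (f i) (ring_on A)" for i
    using primeideal_ring_on[OF A] zero P M by (simp add: f_def)
  moreover have "f i \<subset> f (Suc i)" if "i < 2" for i
  proof -
    have "{0} \<subset> P"
      using x submodule_ofD(2)[OF PD(1)] by auto
    moreover have "P \<subset> M"
      using N(2,3) M(2) a(2) by blast
    moreover have "i = 0 \<or> i = 1"
      using that by auto
    ultimately show ?thesis by (auto simp: f_def)
  qed
  ultimately have "enat 2 \<le> krull_dim A"
    unfolding krull_dim_def by (intro SUP_upper) auto
  with dim have "enat 2 \<le> 1"
    by (rule order_trans[rotated])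
  then show False
    by (simp add: one_enat_def)
qed

text \<open>Every prime of \<open>R\<close> over \<open>C\<close> contracts to a maximal ideal of \<open>A\<close>, so by integrality \<open>R / C\<close> is
  zero-dimensional; being reduced, it is von Neumann regular.\<close>
lemma von_neumann_regular_mod:
  assumes A: "is_subring A" and R: "is_subring R" "A \<subseteq> R" and int: "integral_extension A R"
    and inv: "\<And>P a. prime_in A P \<Longrightarrow> C \<inter> A \<subseteq> P \<Longrightarrow> a \<in> A \<Longrightarrow> a \<notin> P \<Longrightarrow> \<exists>y\<in>A. 1 - a * y \<in> P"
    and C: "submodule_of R R C" and radical: "\<And>x n. x \<in> R \<Longrightarrow> x ^ n \<in> C \<Longrightarrow> x \<in> C"
    and x: "x \<in> R"
  shows "\<exists>y\<in>R. x * (1 - x * y) \<in> C"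
proof -
  note RI = mem_intros[OF R(1)] and CD = submodule_ofD[OF C]
  \<comment> \<open>The multiplicative set generated by \<open>x\<close> and 1 + xR: a prime
    avoiding it would contain neither \<open>x\<close> nor any \<open>1 - x * y\<close>.\<close>
  define S where "S = {x ^ n * (1 - x * y) | n y. y \<in> R}"
  have S1: "1 \<in> S"
    unfolding S_def by (intro CollectI exI[of _ 0]) (auto intro: RI)
  have Smult: "a * b \<in> S" if ab: "a \<in> S" "b \<in> S" for a b
  proof -
    obtain n y m z where eqs: "a = x ^ n * (1 - x * y)" "b = x ^ m * (1 - x * z)" and yz: "y \<in> R" "z \<in> R"
      using ab unfolding S_def by blast
    have "a * b = x ^ (n + m) * (1 - x * (y + z - x * y * z))"
      unfolding eqs by (simp add: algebra_simps power_add)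
    moreover have "y + z - x * y * z \<in> R"
      by (intro RI yz x)
    ultimately show ?thesis
      by (auto simp: S_def)
  qed
  have "C \<inter> S \<noteq> {}"
  proof
    assume "C \<inter> S = {}"
    then obtain Q where Q: "prime_in R Q" "C \<subseteq> Q" "Q \<inter> S = {}"
      using exists_prime_avoiding[OF R(1) C S1 Smult] by blast
    note QD = prime_inD[OF Q(1)] and QS = submodule_ofD[OF prime_inD(1)[OF Q(1)]]
    have "prime_in A (Q \<inter> A)"
      using QD R(2) by (auto simp: prime_in_def submodule_of_def mem_intros[OF A])
    then have inv': "\<exists>y\<in>A. 1 - a * y \<in> Q" if "a \<in> A" "a \<notin> Q" for a
      using inv[of "Q \<inter> A" a] Q(2) that by auto
    have "x ^ 1 * (1 - x * 0) \<in> S"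
      unfolding S_def using zero_mem[OF R(1)] by blast
    then have xQ: "x \<notin> Q"
      using Q(3) by auto
    have "1 - x * y \<notin> Q" if "y \<in> R" for y
    proof -
      have "x ^ 0 * (1 - x * y) \<in> S"
        unfolding S_def using that by blast
      then show ?thesis using Q(3) by auto
    qed
    \<comment> \<open>A nontrivial polynomial relation for \<open>x\<close> modulo \<open>Q\<close>
      makes \<open>x\<close> invertible there: a constant term in \<open>Q\<close> is dropped and
      \<open>x\<close> cancelled, any other constant term is a unit modulo \<open>Q\<close>. The
      monic equation of \<open>x\<close> is such a relation.\<close>
    moreover have "\<exists>y\<in>R. 1 - x * y \<in> Q"
      if "\<forall>i. Polynomial.coeff p i \<in> A" "poly p x \<in> Q" "\<exists>i. Polynomial.coeff p i \<notin> Q" for p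
      using that
    proof (induction p)
      case 0
      then show ?case using QS(2) by auto
    next
      case (pCons a p)
      have a: "a \<in> A"
        using pCons.prems(1)[rule_format, of 0] by simp
      have p: "Polynomial.coeff p i \<in> A" for i
        using pCons.prems(1)[rule_format, of "Suc i"] by simp
      have px: "poly p x \<in> R"
        using p R(2) by (auto simp: poly_altdef intro!: sum_mem[OF R(1)] RI x)
      show ?case
      proof (cases "a \<in> Q")
        case True
        have "(a + x * poly p x) - a \<in> Q"
          using pCons.prems(2) True by (intro submodule_of_diff[OF R(1) QD(1)]) auto
        then have "poly p x \<in> Q"
          using QD(3)[OF x px] xQ by simp
        moreover have "\<exists>i. Polynomial.coeff p i \<notin> Q"
          using pCons.prems(3) True by (metis coeff_pCons_0 coeff_pCons_Suc not0_implies_Suc)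
        ultimately show ?thesis
          using pCons.IH p by blast
      next
        case False
        then obtain a' where a': "a' \<in> A" "1 - a * a' \<in> Q"
          using inv' a by blast
        have "(1 - a * a') + a' * (a + x * poly p x) \<in> Q"
          using pCons.prems(2) a' R(2) by (intro QS(3)[OF a'(2) QS(4)]) auto
        then have "1 - x * (- (a' * poly p x)) \<in> Q"
          by (simp add: algebra_simps)
        moreover have "- (a' * poly p x) \<in> R"
          using a' R(2) by (intro RI px) auto
        ultimately show ?thesis by blast
      qed
    qed
    moreover obtain p where "lead_coeff p = 1" "\<forall>i. Polynomial.coeff p i \<in> A" "poly p x = 0"
      using int x by (auto simp: integral_extension_def)
    ultimately show False
      using QD(2) QS(2) by metis
  qed
  then obtain n y where y: "x ^ n * (1 - x * y) \<in> C" "y \<in> R"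
    by (auto simp: S_def)
  \<comment> \<open>The extra factor completes the power \<open>n + 1\<close> of
    \<open>x * (1 - x * y)\<close>, so that radicality applies.\<close>
  have "(x ^ n * (1 - x * y)) * (x * (1 - x * y) ^ n) \<in> C"
    by (intro CD(5) y RI x)
  also have "(x ^ n * (1 - x * y)) * (x * (1 - x * y) ^ n) = (x * (1 - x * y)) ^ Suc n"
    by (simp add: power_mult_distrib mult_ac)
  finally have "x * (1 - x * y) \<in> C"
    by (rule radical[rotated]) (intro RI x y)
  then show ?thesis
    using y(2) by blast
qed

subsection \<open>Long division modulo a prime ideal\<close>

context
  fixes A R Q :: "'a::comm_ring_1 set" and I J :: "(int \<Rightarrow>\<^sub>0 'a) set"
  assumes RE: "ring_extension A R" and Q: "prime_in R Q"
    and inv: "\<And>a. a \<in> A \<Longrightarrow> a \<notin> Q \<Longrightarrow> \<exists>y\<in>A. 1 - a * y \<in> Q"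
    and I: "submodule_of (laurent A) (laurent R) I" and J: "submodule_of (laurent A) (laurent R) J"
    and IJ: "submodule_prod I J = laurent A"
begin

text \<open>The support of the image of \<open>f\<close> over R / Q. The quotient is never formed;
  all statements are congruences modulo \<open>Q\<close> or \<open>laurent Q\<close>.\<close>

private definition supp :: "(int \<Rightarrow>\<^sub>0 'a) \<Rightarrow> int set" where
  "supp f = {n. Poly_Mapping.lookup f n \<notin> Q}"

text \<open>The Euclidean size modulo \<open>Q\<close>, unchanged by multiplication with powers of
  X. The \<open>+ 1\<close> separates monomials, of width 1, from zero, of width 0.\<close>

private definition width :: "(int \<Rightarrow>\<^sub>0 'a) \<Rightarrow> nat" where
  "width f = (if supp f = {} then 0 else nat (Max (supp f) - Min (supp f) + 1))"

private lemmas A = ring_extensionD(1)[OF RE] and R = ring_extensionD(2)[OF RE]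
  and A_subset_R = subsetD[OF ring_extensionD(3)[OF RE]]
  and LR = is_subring_laurent[OF ring_extensionD(2)[OF RE]]
  and QD = prime_inD[OF Q]
  and QS = submodule_ofD[OF prime_inD(1)[OF Q]]
  and LQS = submodule_ofD[OF submodule_of_laurent[OF prime_inD(1)[OF Q]]]

private lemma laurent_A_subset: "f \<in> laurent A \<Longrightarrow> f \<in> laurent R"
  by (auto simp: laurent_def A_subset_R)

private lemma finite_supp: "finite (supp f)"
  by (rule finite_subset[OF _ finite_keys[of f]]) (auto simp: supp_def in_keys_iff QS(2))

private lemma mem_Q_cong:
  assumes "x - y \<in> Q"
  shows "x \<in> Q \<longleftrightarrow> y \<in> Q"
proof
  show "y \<in> Q" if "x \<in> Q"
    using submodule_of_diff[OF R QD(1) that assms] by simp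
  show "x \<in> Q" if "y \<in> Q"
    using QS(3)[OF assms that] by simp
qed

private lemma supp_cong: "f - g \<in> laurent Q \<Longrightarrow> supp f = supp g"
  using mem_Q_cong by (auto simp: supp_def laurent_def lookup_minus)

private lemma int_width: "supp f \<noteq> {} \<Longrightarrow> int (width f) = Max (supp f) - Min (supp f) + 1"
  using Max_ge[OF finite_supp Min_in[OF finite_supp]] by (auto simp: width_def)

private lemma width_le:
  assumes "supp f \<subseteq> {a..<b}" "a < b"
  shows "int (width f) \<le> b - a"
proof (cases "supp f = {}")
  case False
  then have "Max (supp f) \<in> {a..<b}" "Min (supp f) \<in> {a..<b}"
    using assms(1) Max_in[OF finite_supp False] Min_in[OF finite_supp False] by blast+
  then show ?thesis
    unfolding int_width[OF False] by auto
qed (use assms in \<open>auto simp: width_def\<close>)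

text \<open>Modulo \<open>Q\<close> only one term of the convolution survives. It is applied to the
  top and to the bottom exponents of both factors.\<close>

private lemma lookup_times_cong:
  assumes f: "f \<in> laurent R" and g: "g \<in> laurent R"
    and uniq: "\<And>i j. i \<in> supp f \<Longrightarrow> j \<in> supp g \<Longrightarrow> i + j = n + m \<Longrightarrow> i = n"
  shows "Poly_Mapping.lookup (f * g) (n + m) - Poly_Mapping.lookup f n * Poly_Mapping.lookup g m \<in> Q"
proof -
  let ?t = "\<lambda>i. Poly_Mapping.lookup f i * Poly_Mapping.lookup g (n + m - i)"
  let ?K = "Poly_Mapping.keys f"
  \<comment> \<open>The exponent \<open>n\<close> need not be a key of \<open>f\<close>; inserting
    it then adds a zero term.\<close>
  have "Poly_Mapping.lookup (f * g) (n + m) = sum ?t (insert n ?K)"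
    unfolding lookup_times_int by (rule sum.mono_neutral_left) (auto simp: in_keys_iff)
  also have "\<dots> = ?t n + sum ?t (insert n ?K - {n})"
    by (rule sum.remove) auto
  finally have "Poly_Mapping.lookup (f * g) (n + m) - Poly_Mapping.lookup f n * Poly_Mapping.lookup g m =
      sum ?t (insert n ?K - {n})"
    by simp
  also have "\<dots> \<in> Q"
  proof (rule submodule_of_sum[OF QD(1)])
    fix i assume "i \<in> insert n ?K - {n}"
    then have "i \<notin> supp f \<or> n + m - i \<notin> supp g"
      using uniq[of i "n + m - i"] by auto
    then show "?t i \<in> Q"
      using QS(4,5) laurentD[OF f] laurentD[OF g] by (auto simp: supp_def)
  qed
  finally show ?thesis .
qed

private lemma not_mem_Q_mult: "x \<in> R \<Longrightarrow> y \<in> R \<Longrightarrow> x \<notin> Q \<Longrightarrow> y \<notin> Q \<Longrightarrow> x * y \<notin> Q"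
  using QD(3) by blast

private lemma Max_supp_cong:
  assumes "f \<in> laurent R" "g \<in> laurent R" "supp f \<noteq> {}" "supp g \<noteq> {}"
  shows "Poly_Mapping.lookup (f * g) (Max (supp f) + Max (supp g)) -
    Poly_Mapping.lookup f (Max (supp f)) * Poly_Mapping.lookup g (Max (supp g)) \<in> Q"
proof (rule lookup_times_cong[OF assms(1,2)])
  fix i j assume "i \<in> supp f" "j \<in> supp g" "i + j = Max (supp f) + Max (supp g)"
  then show "i = Max (supp f)"
    using Max_ge[OF finite_supp, of i f] Max_ge[OF finite_supp, of j g] by linarith
qed

text \<open>As R / Q is a domain, the product of the leading coefficients does not vanish modulo
  \<open>Q\<close>.\<close>

private lemma Max_supp_times:
  assumes "f \<in> laurent R" "g \<in> laurent R" "supp f \<noteq> {}" "supp g \<noteq> {}"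
  shows "Max (supp f) + Max (supp g) \<in> supp (f * g)"
  using mem_Q_cong[OF Max_supp_cong[OF assms]] Max_in[OF finite_supp assms(3)] Max_in[OF finite_supp assms(4)]
    not_mem_Q_mult laurentD[OF assms(1)] laurentD[OF assms(2)] by (auto simp: supp_def)

private lemma Min_supp_times:
  assumes "f \<in> laurent R" "g \<in> laurent R" "supp f \<noteq> {}" "supp g \<noteq> {}"
  shows "Min (supp f) + Min (supp g) \<in> supp (f * g)"
proof -
  have "Poly_Mapping.lookup (f * g) (Min (supp f) + Min (supp g)) -
    Poly_Mapping.lookup f (Min (supp f)) * Poly_Mapping.lookup g (Min (supp g)) \<in> Q"
  proof (rule lookup_times_cong[OF assms(1,2)])
    fix i j assume "i \<in> supp f" "j \<in> supp g" "i + j = Min (supp f) + Min (supp g)"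
    then show "i = Min (supp f)"
      using Min_le[OF finite_supp, of i f] Min_le[OF finite_supp, of j g] by linarith
  qed
  from mem_Q_cong[OF this] show ?thesis
    using Min_in[OF finite_supp assms(3)] Min_in[OF finite_supp assms(4)]
      not_mem_Q_mult laurentD[OF assms(1)] laurentD[OF assms(2)] by (auto simp: supp_def)
qed

private lemma supp_one: "supp 1 = {0}"
  by (auto simp: supp_def lookup_one when_def QD(2) QS(2))

private lemma supp_empty_iff: "supp f = {} \<longleftrightarrow> f \<in> laurent Q"
  by (auto simp: supp_def laurent_def)

private lemma one_mem_IJ: "1 \<in> submodule_prod I J"
  using IJ one_mem[OF is_subring_laurent[OF A]] by simp

text \<open>If \<open>I\<close> or \<open>J\<close> vanished modulo \<open>Q\<close>, so would their
  product, which contains 1.\<close>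

private lemma exists_supp_nonempty: "\<exists>f\<in>I. supp f \<noteq> {}" "\<exists>g\<in>J. supp g \<noteq> {}"
proof -
  have "z \<in> laurent Q" if "z \<in> submodule_prod I J" "I \<subseteq> laurent Q \<or> J \<subseteq> laurent Q" for z
    using that(1)
  proof (induction rule: submodule_prod_induct)
    case (mult f g)
    then show ?case
      using that(2) LQS(4,5) submodule_ofD(1)[OF I] submodule_ofD(1)[OF J] by blast
  qed (auto intro: LQS)
  from this[OF one_mem_IJ] have "\<not> (I \<subseteq> laurent Q \<or> J \<subseteq> laurent Q)"
    using supp_one supp_empty_iff by blast
  then show "\<exists>f\<in>I. supp f \<noteq> {}" "\<exists>g\<in>J. supp g \<noteq> {}"
    using supp_empty_iff by blast+
qed

text \<open>Long division: leading coefficients of elements of \<open>I\<close> differ by a factor from the field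
  \<open>A / (A \<inter> Q)\<close>, since both lie in \<open>A\<close> after multiplication by that of a fixed element of \<open>J\<close>.\<close>
private lemma division:
  assumes f: "f \<in> I" "supp f \<noteq> {}" and min: "\<And>h. h \<in> I \<Longrightarrow> supp h \<noteq> {} \<Longrightarrow> width f \<le> width h"
    and "h \<in> I"
  shows "\<exists>r\<in>laurent A. h - r * f \<in> laurent Q"
  using \<open>h \<in> I\<close>
proof (induction "width h" arbitrary: h rule: less_induct)
  case less
  show ?case
  proof (cases "supp h = {}")
    case True
    then show ?thesis
      using zero_mem[OF is_subring_laurent[OF A]] by (intro bexI[of _ 0]) (auto simp: supp_empty_iff)
  next
    case False
    obtain g where g: "g \<in> J" "supp g \<noteq> {}"
      using exists_supp_nonempty(2) by blast
    note mem = submodule_ofD(1)[OF I f(1)] submodule_ofD(1)[OF I less.prems] submodule_ofD(1)[OF J g(1)]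
    note memR = laurentD[OF mem(1)] laurentD[OF mem(2)] laurentD[OF mem(3)]
    have prod_A: "k * g \<in> laurent A" if "k \<in> I" for k
      using submodule_prod_mult[OF that g(1)] IJ by simp
    define F H G where "F = Max (supp f)" and "H = Max (supp h)" and "G = Max (supp g)"
    \<comment> \<open>Both lie in \<open>A\<close> because \<open>f * g\<close> and
      \<open>h * g\<close> are in \<open>laurent A\<close>; modulo \<open>Q\<close> they are the
      leading coefficients of \<open>f\<close> and \<open>h\<close>, each times that of
      \<open>g\<close>.\<close>
    define \<alpha> \<beta> where "\<alpha> = Poly_Mapping.lookup (f * g) (F + G)" and "\<beta> = Poly_Mapping.lookup (h * g) (H + G)"
    have \<alpha>: "\<alpha> \<in> A" "\<alpha> - Poly_Mapping.lookup f F * Poly_Mapping.lookup g G \<in> Q"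
      using Max_supp_cong[OF mem(1,3) f(2) g(2)] laurentD[OF prod_A[OF f(1)]] by (auto simp: \<alpha>_def F_def G_def)
    have \<beta>: "\<beta> \<in> A" "\<beta> - Poly_Mapping.lookup h H * Poly_Mapping.lookup g G \<in> Q"
      using Max_supp_cong[OF mem(2,3) False g(2)] laurentD[OF prod_A[OF less.prems]] by (auto simp: \<beta>_def H_def G_def)
    have "\<alpha> \<notin> Q"
      using Max_supp_times[OF mem(1,3) f(2) g(2)] by (auto simp: \<alpha>_def F_def G_def supp_def)
    then obtain \<alpha>' where \<alpha>': "\<alpha>' \<in> A" "1 - \<alpha> * \<alpha>' \<in> Q"
      using inv \<alpha>(1) by blast
    define a where "a = \<beta> * \<alpha>'"
    have a: "a \<in> A"
      unfolding a_def by (intro mult_mem[OF A] \<beta> \<alpha>')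
    \<comment> \<open>The terms with \<alpha> and \<beta> cancel by the choice of \<open>a\<close>,
      leaving a multiple of the leading coefficient of \<open>g\<close>, which can be cancelled
      modulo the prime \<open>Q\<close>.\<close>
    have "(\<beta> - Poly_Mapping.lookup h H * Poly_Mapping.lookup g G)
        - (a * (\<alpha> - Poly_Mapping.lookup f F * Poly_Mapping.lookup g G) + \<beta> * (1 - \<alpha> * \<alpha>')) \<in> Q"
      using a \<beta> \<alpha> \<alpha>' A_subset_R by (intro submodule_of_diff[OF R QD(1) \<beta>(2) QS(3)[OF QS(4)[OF _ \<alpha>(2)] QS(4)[OF _ \<alpha>'(2)]]]) auto
    then have "(a * Poly_Mapping.lookup f F - Poly_Mapping.lookup h H) * Poly_Mapping.lookup g G \<in> Q"
      by (simp add: a_def algebra_simps)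
    moreover have "Poly_Mapping.lookup g G \<notin> Q"
      using Max_in[OF finite_supp g(2)] by (simp add: G_def supp_def)
    moreover have "a * Poly_Mapping.lookup f F - Poly_Mapping.lookup h H \<in> R"
      by (intro mem_intros[OF R] memR A_subset_R a)
    ultimately have lead: "a * Poly_Mapping.lookup f F - Poly_Mapping.lookup h H \<in> Q"
      using QD(3) memR(3) by blast
    define s where "s = Poly_Mapping.single (H - F) a"
    have s: "s \<in> laurent A"
      by (simp add: s_def single_in_laurent_iff zero_mem[OF A] a)
    let ?h = "h - s * f"
    have hI: "?h \<in> I"
      by (intro submodule_of_diff[OF is_subring_laurent[OF A] I] less.prems submodule_ofD(4)[OF I] s f)
    \<comment> \<open>Minimality of the width of \<open>f\<close> keeps the shifted support of
      \<open>f\<close> from reaching below the bottom exponent of \<open>h\<close>.\<close>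
    have "H - Min (supp h) \<ge> F - Min (supp f)"
      using min[OF less.prems False] int_width[OF f(2)] int_width[OF False] by (simp add: F_def H_def)
    moreover have fH: "n \<in> supp f \<Longrightarrow> Min (supp f) \<le> n \<and> n \<le> F" "n \<in> supp h \<Longrightarrow> Min (supp h) \<le> n \<and> n \<le> H" for n
      by (auto simp: F_def H_def finite_supp)
    ultimately have "n \<in> {Min (supp h)..<H}" if n: "n \<in> supp ?h" for n
    proof -
      have hn: "Poly_Mapping.lookup ?h n = Poly_Mapping.lookup h n - a * Poly_Mapping.lookup f (n - (H - F))"
        by (simp add: lookup_minus s_def)
      have "n \<in> supp h \<or> n - (H - F) \<in> supp f"
      proof (rule ccontr)
        assume "\<not> ?thesis"
        then have "Poly_Mapping.lookup ?h n \<in> Q"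
          unfolding hn using a A_subset_R by (intro submodule_of_diff[OF R QD(1)] QS(4)) (auto simp: supp_def)
        with n show False by (simp add: supp_def)
      qed
      moreover have "n \<noteq> H"
      proof
        assume "n = H"
        then have "Poly_Mapping.lookup ?h n = 0 - (a * Poly_Mapping.lookup f F - Poly_Mapping.lookup h H)"
          unfolding hn by simp
        also have "\<dots> \<in> Q"
          by (intro submodule_of_diff[OF R QD(1)] lead QS)
        finally show False
          using n by (simp add: supp_def)
      qed
      ultimately show ?thesis
        using fH(1)[of "n - (H - F)"] fH(2)[of n] \<open>H - Min (supp h) \<ge> F - Min (supp f)\<close> by auto
    qed
    moreover have "width ?h < width h" if *: "supp ?h \<subseteq> {Min (supp h)..<H}"
    proof (cases "Min (supp h) < H")
      case True
      from width_le[OF * this] show ?thesis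
        using int_width[OF False] by (simp add: H_def)
    next
      \<comment> \<open>Here \<open>h\<close> is a monomial modulo \<open>Q\<close>, so the
        difference vanishes there and the width drops from 1 to 0.\<close>
      case False
      with * have "supp ?h = {}" by auto
      then show ?thesis
        using int_width[OF \<open>supp h \<noteq> {}\<close>] Max_ge[OF finite_supp Min_in[OF finite_supp \<open>supp h \<noteq> {}\<close>]]
        by (simp add: width_def)
    qed
    ultimately have "width ?h < width h" by blast
    from less.hyps[OF this hI] obtain r where r: "r \<in> laurent A" "?h - r * f \<in> laurent Q"
      by blast
    show ?thesis
      using r s by (intro bexI[of _ "s + r"] add_mem[OF is_subring_laurent[OF A]]) (auto simp: algebra_simps)
  qed
qed

text \<open>An element \<open>f\<close> of least width generates \<open>I\<close> modulo
  \<open>Q\<close> and is a unit there, hence a monomial cX^N. Then \<open>h\<close> is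
  \<open>f\<close> times some \<open>r\<close> over \<open>A\<close>, and the factor
  \<open>c\<close> is absorbed into \<open>f * g\<close>, which has coefficients in
  \<open>A\<close>.\<close>

lemma coeff_mult_mem_mod_prime:
  assumes h: "h \<in> I" and g: "g \<in> J"
  shows "\<exists>a\<in>A. Poly_Mapping.lookup h m * Poly_Mapping.lookup g l - a \<in> Q"
proof -
  obtain f0 where "f0 \<in> I \<and> supp f0 \<noteq> {}"
    using exists_supp_nonempty(1) by blast
  from ex_has_least_nat[of "\<lambda>f. f \<in> I \<and> supp f \<noteq> {}", OF this, of width]
  obtain f where f: "f \<in> I" "supp f \<noteq> {}" and min: "\<And>h. h \<in> I \<Longrightarrow> supp h \<noteq> {} \<Longrightarrow> width f \<le> width h"
    by blast
  note fR = submodule_ofD(1)[OF I f(1)] and gR = submodule_ofD(1)[OF J g]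
  \<comment> \<open>Every element of \<open>submodule_prod I J\<close> is a multiple of
    \<open>f\<close> modulo \<open>Q\<close>; for 1 this gives an inverse \<open>t\<close>.\<close>
  have "\<exists>t\<in>laurent R. z - f * t \<in> laurent Q" if "z \<in> submodule_prod I J" for z
    using that
  proof (induction rule: submodule_prod_induct)
    case zero
    show ?case
      using zero_mem[OF LR] LQS(2) by (intro bexI[of _ 0]) auto
  next
    case (add x y)
    then obtain t u where tu: "t \<in> laurent R" "x - f * t \<in> laurent Q" "u \<in> laurent R" "y - f * u \<in> laurent Q"
      by blast
    have "(x - f * t) + (y - f * u) \<in> laurent Q"
      by (intro LQS(3) tu)
    then show ?case
      using tu by (intro bexI[of _ "t + u"] add_mem[OF LR]) (auto simp: algebra_simps)
  next
    case (mult x y)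
    obtain r where r: "r \<in> laurent A" "x - r * f \<in> laurent Q"
      using division[OF f min mult(1)] by blast
    have "(x - r * f) * y \<in> laurent Q"
      by (intro LQS(5) r submodule_ofD(1)[OF J mult(2)])
    then show ?case
      using r laurent_A_subset submodule_ofD(1)[OF J mult(2)]
      by (intro bexI[of _ "r * y"] mult_mem[OF LR]) (auto simp: algebra_simps)
  qed
  from this[OF one_mem_IJ] obtain t where t: "t \<in> laurent R" "1 - f * t \<in> laurent Q"
    by blast
  have ft: "supp (f * t) = {0}"
    using supp_cong[OF t(2)] supp_one by simp
  have "supp t \<noteq> {}"
  proof
    assume "supp t = {}"
    then have "f * t \<in> laurent Q"
      using LQS(4)[OF fR] supp_empty_iff by blast
    then show False
      using ft supp_empty_iff by blast
  qed
  \<comment> \<open>Top and bottom exponents of \<open>f\<close> and \<open>t\<close> both sum to 0,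
    so neither support can have positive length.\<close>
  then have "Max (supp f) + Max (supp t) = 0" "Min (supp f) + Min (supp t) = 0"
    using Max_supp_times[OF fR t(1) f(2)] Min_supp_times[OF fR t(1) f(2)] ft by auto
  moreover have "Min (supp k) \<le> Max (supp k)" if "supp k \<noteq> {}" for k
    using Max_ge[OF finite_supp Min_in[OF finite_supp that]] .
  ultimately have MinMax: "Min (supp f) = Max (supp f)"
    using f(2) \<open>supp t \<noteq> {}\<close> by (smt (verit))
  define N where "N = Max (supp f)"
  define c where "c = Poly_Mapping.lookup f N"
  have "n = N" if "n \<in> supp f" for n
    using Max_ge[OF finite_supp that] Min_le[OF finite_supp that] MinMax by (simp add: N_def)
  then have "Poly_Mapping.lookup (f - Poly_Mapping.single N c) n \<in> Q" for n
    by (cases "n = N") (auto simp: lookup_minus lookup_single when_def c_def supp_def QS(2))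
  then have fN: "f - Poly_Mapping.single N c \<in> laurent Q"
    by (rule laurentI)
  obtain r where r: "r \<in> laurent A" "h - r * f \<in> laurent Q"
    using division[OF f min h] by blast
  have "(h - r * f) + r * (f - Poly_Mapping.single N c) \<in> laurent Q"
    by (intro LQS(3,4) r fN laurent_A_subset)
  then have "h - Poly_Mapping.single N c * r \<in> laurent Q"
    by (simp add: algebra_simps)
  from laurentD[OF this, of m] have hm: "Poly_Mapping.lookup h m - c * Poly_Mapping.lookup r (m - N) \<in> Q"
    by (simp add: lookup_minus)
  have "(f - Poly_Mapping.single N c) * g \<in> laurent Q"
    by (intro LQS(5) fN gR)
  from laurentD[OF this, of "N + l"]
  have gl: "Poly_Mapping.lookup (f * g) (N + l) - c * Poly_Mapping.lookup g l \<in> Q"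
    by (simp add: lookup_minus left_diff_distrib)
  let ?a = "Poly_Mapping.lookup r (m - N) * Poly_Mapping.lookup (f * g) (N + l)"
  have "f * g \<in> laurent A"
    using submodule_prod_mult[OF f(1) g] IJ by simp
  then have "?a \<in> A"
    by (intro mult_mem[OF A] laurentD[OF r(1)] laurentD)
  moreover have "(Poly_Mapping.lookup h m - c * Poly_Mapping.lookup r (m - N)) * Poly_Mapping.lookup g l -
      Poly_Mapping.lookup r (m - N) * (Poly_Mapping.lookup (f * g) (N + l) - c * Poly_Mapping.lookup g l) \<in> Q"
    by (intro submodule_of_diff[OF R QD(1)] QS(5)[OF hm] QS(4)[OF _ gl] laurentD[OF gR] A_subset_R laurentD[OF r(1)])
  then have "Poly_Mapping.lookup h m * Poly_Mapping.lookup g l - ?a \<in> Q"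
    by (simp add: algebra_simps)
  ultimately show ?thesis by blast
qed

end

subsection \<open>The conductor of a finite birational extension\<close>

text \<open>Below the degree there are enough factors \<open>s\<close> to pair with each
  \<open>b\<close>; higher powers of \<open>b\<close> reduce by the monic equation. Hence one power
  of \<open>s\<close> clears all powers of \<open>b\<close>.\<close>

lemma integral_power_mult_mem:
  assumes A: "is_subring A" and p: "lead_coeff p = 1" "\<forall>i. Polynomial.coeff p i \<in> A" "poly p b = 0"
    and s: "s \<in> A" "s * b \<in> A"
  shows "s ^ degree p * b ^ i \<in> A"
proof (induction i rule: less_induct)
  case (less i)
  let ?n = "degree p"
  show ?case
  proof (cases "i < ?n")
    case True
    have "s ^ (?n - i) * (s * b) ^ i = s ^ (?n - i + i) * b ^ i"
      by (simp only: power_mult_distrib power_add mult.assoc)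
    then have "s ^ ?n * b ^ i = s ^ (?n - i) * (s * b) ^ i"
      using True by simp
    also have "\<dots> \<in> A"
      by (intro mem_intros[OF A] s)
    finally show ?thesis .
  next
    case False
    have "b ^ ?n = - (\<Sum>j<?n. Polynomial.coeff p j * b ^ j)"
      using p(1,3) by (simp add: poly_altdef lessThan_Suc_atMost[symmetric] eq_neg_iff_add_eq_0 add.commute)
    then have "b ^ (i - ?n) * b ^ ?n = - (\<Sum>j<?n. Polynomial.coeff p j * b ^ (i - ?n + j))"
      by (simp add: sum_distrib_left power_add mult_ac)
    then have "b ^ i = - (\<Sum>j<?n. Polynomial.coeff p j * b ^ (i - ?n + j))"
      using False by (simp flip: power_add)
    then have "s ^ ?n * b ^ i = - (\<Sum>j<?n. Polynomial.coeff p j * (s ^ ?n * b ^ (i - ?n + j)))"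
      by (simp add: sum_distrib_left mult_ac)
    also have "\<dots> \<in> A"
      using p(2) False by (intro uminus_mem[OF A] sum_mem[OF A] mult_mem[OF A] less.IH) auto
    finally show ?thesis .
  qed
qed

lemma is_subring_adjoin:
  assumes R: "is_subring R"
  shows "is_subring {poly p b | p. \<forall>i. Polynomial.coeff p i \<in> R}" (is "is_subring ?S")
proof (rule is_subringI)
  have *: "poly p b \<in> ?S" if "\<And>i. Polynomial.coeff p i \<in> R" for p
    using that by blast
  have "poly 1 b \<in> ?S"
    using zero_mem[OF R] one_mem[OF R] by (intro *) (auto simp: coeff_1)
  then show "1 \<in> ?S" by simp
  show "- x \<in> ?S" if x: "x \<in> ?S" for x
  proof -
    obtain p where p: "x = poly p b" "\<And>i. Polynomial.coeff p i \<in> R"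
      using x by blast
    have "poly (- p) b \<in> ?S"
      using p by (intro *) (auto intro: uminus_mem[OF R])
    then show ?thesis by (simp add: p)
  qed
  show "x + y \<in> ?S" if xy: "x \<in> ?S" "y \<in> ?S" for x y
  proof -
    obtain p q where pq: "x = poly p b" "y = poly q b" "\<And>i. Polynomial.coeff p i \<in> R" "\<And>i. Polynomial.coeff q i \<in> R"
      using xy by blast
    have "poly (p + q) b \<in> ?S"
      using pq by (intro *) (auto intro: add_mem[OF R])
    then show ?thesis by (simp add: pq)
  qed
  show "x * y \<in> ?S" if xy: "x \<in> ?S" "y \<in> ?S" for x y
  proof -
    obtain p q where pq: "x = poly p b" "y = poly q b" "\<And>i. Polynomial.coeff p i \<in> R" "\<And>i. Polynomial.coeff q i \<in> R"
      using xy by blast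
    have "poly (p * q) b \<in> ?S"
      using pq by (intro *) (auto simp: coeff_mult intro!: sum_mem[OF R] mult_mem[OF R])
    then show ?thesis by (simp add: pq)
  qed
qed

text \<open>The elements of \<open>F\<close> are adjoined one at a time. Birationality gives a
  denominator \<open>s\<close> of \<open>b\<close> in \<open>A\<close>, and integrality lets a fixed
  power of \<open>s\<close> clear every power of \<open>b\<close>.\<close>

lemma exists_subring_with_nonzero_conductor:
  fixes A B :: "'a::idom set"
  assumes AB: "ring_extension A B" and int: "integral_extension A B" and bir: "birational A B"
    and "finite F" "F \<subseteq> B"
  shows "\<exists>R c. is_subring R \<and> A \<subseteq> R \<and> R \<subseteq> B \<and> F \<subseteq> R \<and> c \<in> A \<and> c \<noteq> 0 \<and> (\<forall>x\<in>R. c * x \<in> A)"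
  using \<open>finite F\<close> \<open>F \<subseteq> B\<close>
proof (induction F rule: finite_induct)
  case empty
  note A = ring_extensionD(1)[OF AB]
  show ?case
    using A ring_extensionD(3)[OF AB] one_mem[OF A] by (intro exI[of _ A] exI[of _ 1]) auto
next
  case (insert b F)
  note A = ring_extensionD(1)[OF AB] and B = ring_extensionD(2)[OF AB]
  obtain R c where R: "is_subring R" "A \<subseteq> R" "R \<subseteq> B" "F \<subseteq> R" and c: "c \<in> A" "c \<noteq> 0" "\<And>x. x \<in> R \<Longrightarrow> c * x \<in> A"
    using insert by auto
  have b: "b \<in> B"
    using insert.prems by simp
  then have "Fract b 1 \<in> quotient_field B"
    unfolding quotient_field_def using one_mem[OF B] by (intro CollectI exI[of _ b] exI[of _ 1]) simp
  then obtain a s where as: "Fract b 1 = Fract a s" "a \<in> A" "s \<in> A" "s \<noteq> 0"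
    unfolding bir[unfolded birational_def, symmetric] unfolding quotient_field_def by blast
  then have sb: "s * b \<in> A"
    by (simp add: eq_fract mult.commute)
  obtain p where p: "lead_coeff p = 1" "\<forall>i. Polynomial.coeff p i \<in> A" "poly p b = 0"
    using int b by (auto simp: integral_extension_def)
  note pow = integral_power_mult_mem[OF A p as(3) sb]
  let ?R = "{poly q b | q. \<forall>i. Polynomial.coeff q i \<in> R}" and ?c = "c * s ^ degree p"
  have poly_mem: "poly q b \<in> S" if "is_subring S" "\<forall>i. Polynomial.coeff q i \<in> S" "b \<in> S" for q S
    unfolding poly_altdef using that
    by (auto intro!: sum_mem[OF that(1)] mult_mem[OF that(1)] power_mem[OF that(1)])
  show ?case
  proof (intro exI[of _ ?R] exI[of _ ?c] conjI ballI)
    show "is_subring ?R"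
      by (rule is_subring_adjoin[OF R(1)])
    show "?R \<subseteq> B"
      using poly_mem[OF B _ b] R(3) by blast
    have const: "r \<in> ?R" if "r \<in> R" for r
      using that zero_mem[OF R(1)] by (intro CollectI exI[of _ "[:r:]"]) (auto simp: coeff_pCons split: nat.splits)
    then show "A \<subseteq> ?R"
      using R(2) by blast
    have "b \<in> ?R"
      using zero_mem[OF R(1)] one_mem[OF R(1)]
      by (intro CollectI exI[of _ "[:0, 1:]"]) (auto simp: coeff_pCons split: nat.splits)
    then show "insert b F \<subseteq> ?R"
      using const R(4) by blast
    show "?c \<in> A" "?c \<noteq> 0"
      using c as by (auto intro!: mult_mem[OF A] power_mem[OF A])
    fix x assume "x \<in> ?R"
    then obtain q where q: "x = poly q b" "\<forall>i. Polynomial.coeff q i \<in> R"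
      by blast
    \<comment> \<open>The factor \<open>c\<close> moves the coefficients into \<open>A\<close>, the
      power of \<open>s\<close> the powers of \<open>b\<close>.\<close>
    have "?c * x = (\<Sum>i\<le>degree q. (c * Polynomial.coeff q i) * (s ^ degree p * b ^ i))"
      by (simp add: q poly_altdef sum_distrib_left mult_ac)
    also have "\<dots> \<in> A"
      using q by (intro sum_mem[OF A] mult_mem[OF A] pow c) auto
    finally show "?c * x \<in> A" .
  qed
qed

definition conductor :: "'a::comm_ring_1 set \<Rightarrow> 'a set \<Rightarrow> 'a set" where
  "conductor A R = {x \<in> R. \<forall>y\<in>R. x * y \<in> A}"

lemma conductor_subset: "is_subring R \<Longrightarrow> conductor A R \<subseteq> A"
  using one_mem[of R] by (force simp: conductor_def)

lemma submodule_of_conductor: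
  assumes A: "is_subring A" and R: "is_subring R"
  shows "submodule_of R R (conductor A R)"
  unfolding submodule_of_def
proof (intro conjI ballI)
  show "conductor A R \<subseteq> R" "0 \<in> conductor A R"
    using zero_mem[OF A] zero_mem[OF R] by (auto simp: conductor_def)
next
  fix x y assume "x \<in> conductor A R" "y \<in> conductor A R"
  then show "x + y \<in> conductor A R"
    by (simp add: conductor_def distrib_right add_mem[OF A] add_mem[OF R])
next
  fix a x assume "a \<in> R" "x \<in> conductor A R"
  then have mem: "x * (a * y) \<in> A" "a * x \<in> R" if "y \<in> R" for y
    using that by (simp_all add: conductor_def mult_mem[OF R])
  have "a * x * y \<in> A" if "y \<in> R" for y
    using mem(1)[OF that] by (simp add: mult_ac)
  then show "a * x \<in> conductor A R"
    unfolding conductor_def using mem(2)[OF one_mem[OF R]] by blast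
qed

text \<open>If \<open>z\<^sup>2\<close> is in the conductor, then for \<open>y\<close> in
  \<open>R\<close> the square and the cube of \<open>z * y\<close> are multiples of
  \<open>z\<^sup>2\<close>, hence in \<open>A\<close>, so \<open>z * y\<close> is in
  \<open>A\<close>. Other exponents are halved repeatedly.\<close>

lemma conductor_radical:
  assumes A: "is_subring A" and R: "is_subring R" and sub: "subintegrally_closed A R"
    and x: "x \<in> R" "x ^ n \<in> conductor A R"
  shows "x \<in> conductor A R"
  using x
proof (induction n arbitrary: x rule: less_induct)
  case (less n)
  note C = submodule_ofD[OF submodule_of_conductor[OF A R]]
  have square: "z \<in> conductor A R" if z: "z \<in> R" "z\<^sup>2 \<in> conductor A R" for z
    unfolding conductor_def
  proof (intro CollectI conjI ballI z)
    fix y assume y: "y \<in> R"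
    have "z\<^sup>2 * y\<^sup>2 \<in> conductor A R" "z\<^sup>2 * (z * y ^ 3) \<in> conductor A R"
      using y z by (auto intro!: C(5) mem_intros[OF R])
    moreover have "z\<^sup>2 * y\<^sup>2 = (z * y)\<^sup>2" "z\<^sup>2 * (z * y ^ 3) = (z * y) ^ 3"
      by (simp_all add: power2_eq_square power3_eq_cube mult_ac)
    ultimately have "(z * y)\<^sup>2 \<in> A" "(z * y) ^ 3 \<in> A"
      using conductor_subset[OF R] by auto
    then show "z * y \<in> A"
      using sub mult_mem[OF R z(1) y] by (auto simp: subintegrally_closed_def)
  qed
  show ?case
  proof (cases "n \<le> 1")
    case True
    then consider "n = 0" | "n = 1" by linarith
    then show ?thesis
      by cases (use less.prems C(5)[of 1 x] in auto)
  next
    case False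
    \<comment> \<open>Rounding up makes \<open>x ^ (m * 2)\<close> a multiple of
      \<open>x ^ n\<close>; \<open>m < n\<close> holds as \<open>n\<close> is at least 2.\<close>
    define m where "m = (n + 1) div 2"
    have m: "m < n" "n \<le> m * 2"
      using False by (auto simp: m_def)
    have "x ^ n * x ^ (m * 2 - n) \<in> conductor A R"
      by (intro C(5) less.prems power_mem[OF R])
    then have "(x ^ m)\<^sup>2 \<in> conductor A R"
      using m(2) by (simp flip: power_add power_mult)
    then have "x ^ m \<in> conductor A R"
      by (rule square[OF power_mem[OF R less.prems(1)]])
    then show ?thesis
      using less.IH[OF m(1)] less.prems by blast
  qed
qed

text \<open>\<open>Q\<close> is the preimage of the localised conductor \<open>C\<^sub>P\<close>. As \<open>R / C\<close> is von Neumann regular, being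
  anodal forces its idempotents to come from \<open>A\<close>, so that \<open>R / C\<close> localised at \<open>P\<close> is a field.\<close>
lemma exists_prime_over:
  fixes A R :: "'a::idom set"
  assumes AR: "ring_extension A R" and int: "integral_extension A R" and dim: "krull_dim A \<le> 1"
    and sub: "subintegrally_closed A R" and anodal: "anodal A R"
    and c: "c \<in> conductor A R" "c \<noteq> 0" and P: "prime_in A P" "conductor A R \<subseteq> P"
  obtains Q where "prime_in R Q" "P \<subseteq> Q" "\<And>x. x \<in> Q \<Longrightarrow> \<exists>s\<in>A. s \<notin> P \<and> s * x \<in> A"
proof -
  note A = ring_extensionD(1)[OF AR] and R = ring_extensionD(2)[OF AR] and AR' = ring_extensionD(3)[OF AR]
  note AI = mem_intros[OF A] and RI = mem_intros[OF R]
  let ?C = "conductor A R"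
  note C = submodule_of_conductor[OF A R] and CA = conductor_subset[OF R]
  note CD = submodule_ofD[OF C] and PD = prime_inD[OF P(1)] and PS = submodule_ofD[OF prime_inD(1)[OF P(1)]]
  note radical = conductor_radical[OF A R sub]
  have inv: "\<exists>y\<in>A. 1 - a * y \<in> P'" if "prime_in A P'" "?C \<inter> A \<subseteq> P'" "a \<in> A" "a \<notin> P'" for P' a
    using invertible_mod_prime_if_krull_dim_le_1[OF A dim that(1) _ c(2) that(3,4)] that(2) c(1) CA by blast
  have regR: "\<exists>y\<in>R. x * (1 - x * y) \<in> ?C" if "x \<in> R" for x
    by (rule von_neumann_regular_mod[OF A R AR' int inv C radical that])
  \<comment> \<open>A / C is von Neumann regular as well, \<open>A\<close> being integral over
    itself; this is what puts \<open>P\<close> inside \<open>Q\<close>.\<close>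
  have regA: "\<exists>y\<in>A. x * (1 - x * y) \<in> ?C" if "x \<in> A" for x
  proof (rule von_neumann_regular_mod[OF A A order_refl _ inv _ _ that])
    show "integral_extension A A"
      unfolding integral_extension_def
    proof
      fix b assume "b \<in> A"
      then show "\<exists>p. lead_coeff p = 1 \<and> (\<forall>i. Polynomial.coeff p i \<in> A) \<and> poly p b = 0"
        by (intro exI[of _ "[:- b, 1:]"]) (auto simp: coeff_pCons intro: AI split: nat.splits)
    qed
    show "submodule_of A A ?C"
      using C CA AR' by (auto simp: submodule_of_def)
    show "z \<in> ?C" if "z \<in> A" "z ^ n \<in> ?C" for z n
      using radical that AR' by blast
  qed
  define Q where "Q = {x \<in> R. \<exists>s\<in>A. s \<notin> P \<and> s * x \<in> ?C}"
  have QI: "x \<in> Q" if "x \<in> R" "s \<in> A" "s \<notin> P" "s * x \<in> ?C" for x s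
    using that by (auto simp: Q_def)
  have "submodule_of R R Q"
    unfolding submodule_of_def
  proof (intro conjI ballI)
    show "Q \<subseteq> R"
      by (auto simp: Q_def)
    show "0 \<in> Q"
      using PD(2) CD(2) by (intro QI[of _ 1] RI AI) auto
  next
    fix x y assume "x \<in> Q" "y \<in> Q"
    then obtain s t where s: "s \<in> A" "s \<notin> P" "s * x \<in> ?C" "x \<in> R" and t: "t \<in> A" "t \<notin> P" "t * y \<in> ?C" "y \<in> R"
      by (auto simp: Q_def)
    have "t * (s * x) + s * (t * y) \<in> ?C"
      using s t AR' by (intro CD(3)[OF CD(4) CD(4)]) auto
    then show "x + y \<in> Q"
      using s t PD(3)[of s t] by (intro QI[of _ "s * t"] RI AI) (auto simp: algebra_simps)
  next
    fix a x assume a: "a \<in> R" and "x \<in> Q"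
    then obtain s where s: "s \<in> A" "s \<notin> P" "s * x \<in> ?C" "x \<in> R"
      by (auto simp: Q_def)
    have "a * (s * x) \<in> ?C"
      by (intro CD(4) a s)
    then show "a * x \<in> Q"
      using s a by (intro QI[of _ s] RI) (auto simp: mult.left_commute)
  qed
  note QS = submodule_ofD[OF this]
  have PQ: "P \<subseteq> Q"
  proof
    fix a assume a: "a \<in> P"
    obtain y where y: "y \<in> A" "a * (1 - a * y) \<in> ?C"
      using regA PS(1)[OF a] by blast
    have "1 - a * y \<notin> P"
    proof
      assume "1 - a * y \<in> P"
      then have "(1 - a * y) + a * y \<in> P"
        by (intro PS(3) PS(5) a y)
      then show False using PD(2) by simp
    qed
    then show "a \<in> Q"
      using PS(1)[OF a] y AR' by (intro QI[of a "1 - a * y"] AI) (auto simp: mult.commute)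
  qed
  have field: "\<exists>y\<in>R. 1 - x * y \<in> Q" if x: "x \<in> R" "x \<notin> Q" for x
  proof -
    obtain y where y: "y \<in> R" "x * (1 - x * y) \<in> ?C"
      using regR x(1) by blast
    \<comment> \<open>Regularity makes \<open>e\<close> idempotent modulo the conductor, so the
      anodal condition applies to it.\<close>
    define e where "e = x * y"
    have e: "e \<in> R"
      unfolding e_def by (intro RI x y)
    have "(- y) * (x * (1 - x * y)) \<in> ?C"
      by (intro CD(4) RI y)
    then have e2: "e\<^sup>2 - e \<in> ?C"
      by (simp add: e_def algebra_simps power2_eq_square)
    then have "e * (e\<^sup>2 - e) \<in> ?C"
      by (intro CD(4) e)
    then have "e ^ 3 - e\<^sup>2 \<in> ?C"
      by (simp add: algebra_simps power2_eq_square power3_eq_cube)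
    with e2 have "e \<in> A"
      using anodal e CA unfolding anodal_def by blast
    then have "1 - e \<in> A"
      by (intro AI)
    \<comment> \<open>As \<open>1 - e\<close> multiplies \<open>x\<close> into the conductor,
      \<open>x\<close> would lie in \<open>Q\<close> if \<open>1 - e\<close> were outside
      \<open>P\<close>.\<close>
    then have "1 - e \<in> P"
      using QI[OF x(1), of "1 - e"] x(2) y(2) by (auto simp: e_def mult.commute)
    then show ?thesis
      using PQ y(1) by (auto simp: e_def)
  qed
  have "1 \<notin> Q"
    using P(2) by (auto simp: Q_def)
  moreover have "y \<in> Q" if xy: "x \<in> R" "y \<in> R" "x * y \<in> Q" "x \<notin> Q" for x y
  proof -
    obtain z where z: "z \<in> R" "1 - x * z \<in> Q"
      using field xy by blast
    have "y * (1 - x * z) + z * (x * y) \<in> Q"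
      by (intro QS(3,4) xy z)
    then show ?thesis by (simp add: algebra_simps)
  qed
  ultimately have "prime_in R Q"
    using \<open>submodule_of R R Q\<close> by (auto simp: prime_in_def)
  then show thesis
    using PQ CA by (intro that[of Q]) (auto simp: Q_def)
qed

section \<open>Sufficiency: from the primes back to \<open>A\<close>\<close>

text \<open>If the product of coefficients were outside \<open>A\<close>, its ideal of denominators
  would lie in a prime \<open>P\<close>. The congruence modulo a prime \<open>Q\<close> over
  \<open>P\<close> yields a denominator outside \<open>P\<close>.\<close>

lemma coeff_mult_mem_if_anodal:
  fixes A B :: "'a::idom set"
  assumes AB: "ring_extension A B" and int: "integral_extension A B" and bir: "birational A B"
    and dim: "krull_dim A \<le> 1" and sub: "subintegrally_closed A B" and anodal: "anodal A B"
    and I: "submodule_of (laurent A) (laurent B) I" and J: "submodule_of (laurent A) (laurent B) J"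
    and IJ: "submodule_prod I J = laurent A" and f: "f \<in> I" and g: "g \<in> J"
  shows "Poly_Mapping.lookup f n * Poly_Mapping.lookup g m \<in> A" (is "?b \<in> A")
proof (rule ccontr)
  assume b: "?b \<notin> A"
  note A = ring_extensionD(1)[OF AB] and B = ring_extensionD(2)[OF AB]
  note LA = is_subring_laurent[OF A]
  have "1 \<in> submodule_prod I J"
    using IJ one_mem[OF LA] by simp
  then obtain k x y where one: "1 = (\<Sum>i<k. x i * y i)" and xy: "\<And>i. i < (k::nat) \<Longrightarrow> x i \<in> I" "\<And>i. i < k \<Longrightarrow> y i \<in> J"
    by (auto simp: submodule_prod_def)
  \<comment> \<open>The witnesses \<open>x\<close>, \<open>y\<close> of 1 are included so that
    \<open>I\<close> and \<open>J\<close>, cut down to \<open>laurent R\<close>, remain inverse to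
    each other.\<close>
  define H where "H = {f, g} \<union> x ` {..<k} \<union> y ` {..<k}"
  define F where "F = (\<Union>h\<in>H. Poly_Mapping.lookup h ` Poly_Mapping.keys h)"
  have "H \<subseteq> laurent B"
    using submodule_ofD(1)[OF I] submodule_ofD(1)[OF J] f g xy by (auto simp: H_def)
  then have "finite F" "F \<subseteq> B"
    by (auto simp: F_def H_def dest: laurentD)
  from exists_subring_with_nonzero_conductor[OF AB int bir this]
  obtain R c where R: "is_subring R" "A \<subseteq> R" "R \<subseteq> B" "F \<subseteq> R" and c: "c \<in> A" "c \<noteq> 0" "\<And>x. x \<in> R \<Longrightarrow> c * x \<in> A"
    by (elim exE conjE) (rule that, blast+)
  have AR: "ring_extension A R"
    using A R by (simp add: ring_extension_def)
  have H: "h \<in> laurent R" if "h \<in> H" for h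
  proof (rule laurentI)
    fix n show "Poly_Mapping.lookup h n \<in> R"
    proof (cases "n \<in> Poly_Mapping.keys h")
      case True
      then have "Poly_Mapping.lookup h n \<in> F"
        using that by (auto simp: F_def)
      with R(4) show ?thesis by blast
    qed (use zero_mem[OF R(1)] in \<open>simp add: in_keys_iff\<close>)
  qed
  have bR: "?b \<in> R"
    by (intro mult_mem[OF R(1)] laurentD[OF H]) (auto simp: H_def)
  have intR: "integral_extension A R" and subR: "subintegrally_closed A R" and anR: "anodal A R"
    using int sub anodal R(3) by (auto simp: integral_extension_def subintegrally_closed_def anodal_def)
  have cC: "c \<in> conductor A R"
    using c R(2) by (auto simp: conductor_def)
  define D where "D = {a \<in> A. a * ?b \<in> A}"
  have D: "submodule_of A A D"
    by (auto simp: submodule_of_def D_def distrib_right mult.assoc intro: mem_intros[OF A])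
  have "1 \<notin> D"
    using b by (simp add: D_def)
  then obtain P where P: "prime_in A P" "D \<subseteq> P"
    by (rule exists_prime_containing[OF A D])
  \<comment> \<open>The product of coefficients lies in \<open>R\<close>, so the conductor consists
    of denominators and \<open>P\<close> contains it.\<close>
  have "conductor A R \<subseteq> D"
    using conductor_subset[OF R(1), of A] bR by (auto simp: D_def conductor_def)
  then have CP: "conductor A R \<subseteq> P"
    using P(2) by blast
  obtain Q where Q: "prime_in R Q" "P \<subseteq> Q" "\<And>x. x \<in> Q \<Longrightarrow> \<exists>s\<in>A. s \<notin> P \<and> s * x \<in> A"
    by (rule exists_prime_over[OF AR intR dim subR anR cC c(2) P(1) CP]) blast
  have invQ: "\<exists>y\<in>A. 1 - a * y \<in> Q" if "a \<in> A" "a \<notin> Q" for a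
    using invertible_mod_prime_if_krull_dim_le_1[OF A dim P(1) _ c(2)] cC CP Q(2) that by blast
  let ?I = "I \<inter> laurent R" and ?J = "J \<inter> laurent R"
  have LAR: "h \<in> laurent R" if "h \<in> laurent A" for h
    using that R(2) by (auto simp: laurent_def)
  have restrict: "submodule_of (laurent A) (laurent R) (K \<inter> laurent R)"
    if "submodule_of (laurent A) (laurent B) K" for K
    using submodule_ofD(2,3,4)[OF that] LAR unfolding submodule_of_def
    by (auto intro: mem_intros[OF is_subring_laurent[OF R(1)]])
  have "submodule_prod ?I ?J = laurent A"
  proof (rule submodule_prod_eq_ring[OF LA restrict[OF I] restrict[OF J]])
    show "h * h' \<in> laurent A" if "h \<in> ?I" "h' \<in> ?J" for h h'
      using submodule_prod_mult[of h I h' J] that IJ by blast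
    have "x i \<in> ?I \<and> y i \<in> ?J" if "i < k" for i
      using xy that H by (auto simp: H_def)
    then show "1 \<in> submodule_prod ?I ?J"
      unfolding submodule_prod_def using one by blast
  qed
  moreover have "f \<in> ?I" "g \<in> ?J"
    using f g H by (auto simp: H_def)
  ultimately obtain a where a: "a \<in> A" "?b - a \<in> Q"
    using coeff_mult_mem_mod_prime[OF AR Q(1) invQ restrict[OF I] restrict[OF J]] by blast
  then obtain s where s: "s \<in> A" "s \<notin> P" "s * (?b - a) \<in> A"
    using Q(3) by blast
  \<comment> \<open>The sum is \<open>s * ?b\<close>, so \<open>s\<close> is a denominator outside
    \<open>P\<close>.\<close>
  have "s * (?b - a) + s * a \<in> A"
    by (intro mem_intros[OF A] s a)
  then have "s \<in> D"
    using s(1) by (simp add: D_def algebra_simps)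
  with P(2) s(2) show False by blast
qed

theorem theorem2p14:
  fixes A B :: "'a::idom set"
  assumes "ring_extension A B"
    and "integral_extension A B"
    and "birational A B"
    and "krull_dim A \<le> 1"
  shows "trivial_group (MI A B) \<longleftrightarrow> subintegrally_closed A B \<and> anodal A B"
proof
  assume "trivial_group (MI A B)"
  then show "subintegrally_closed A B \<and> anodal A B"
    using subintegrally_closed_if_trivial_MI[OF assms(1)] anodal_if_trivial_MI[OF assms(1)] by simp
next
  assume *: "subintegrally_closed A B \<and> anodal A B"
  show "trivial_group (MI A B)"
    unfolding trivial_group_MI_iff[OF assms(1)]
  proof (intro allI impI)
    fix I assume "invertible_submodule (laurent A) (laurent B) I"
    then obtain J where J: "submodule_of (laurent A) (laurent B) I" "submodule_of (laurent A) (laurent B) J"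
      "submodule_prod I J = laurent A"
      by (auto simp: invertible_submodule_def)
    show "\<exists>K. invertible_submodule A B K \<and> I = laurent K"
      by (rule extended_if_coeff_mult_mem[OF assms(1) J])
        (rule coeff_mult_mem_if_anodal[OF assms conjunct1[OF *] conjunct2[OF *] J])
  qed
qed

end
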